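(* Let $\mathcal{A}$ be a central essential arrangement of $n$ hyperplanes in $V=\mathbb{C}^\ell$. For $p+q=\ell-1$, the exterior product gives a non-degenerate pairing $$-\wedge-:\ \Omega^p_0(\mathcal{A})\times\Omega^q_0(\mathcal{A})\to\Omega^{\ell-1}_0(\mathcal{A})\cong R(n-\ell),$$ and for any $\lambda\in\mathbb{C}^{\mathcal{A}}$ with $|\lambda|=\sum_H\lambda_H=0$ it makes the complex $(\Omega^\bullet_0(\mathcal{A}),\omega_\lambda)$ self-dual.
   Context: $\mathcal{A}$ is a set of $n$ distinct linear hyperplanes in $V=\mathbb{C}^\ell$ with common intersection $\{0\}$; $R=\operatorname{Sym}(V^* )=\mathbb{C}[x_1,\dots,x_\ell]$; each $H\in\mathcal{A}$ is the kernel of a linear form $\alpha_H$, and $f=\prod_{H}\alpha_H$. $\Omega^p_V$ is graded so that $dx_i$ has degree $1$, and $$\Omega^p(\mathcal{A})=\Big\{\omega\in\tfrac1f\Omega^p_V\ \Big|\ \forall H\in\mathcal{A}:\ \tfrac{d\alpha_H}{\alpha_H}\wedge\omega\in\tfrac1f\Omega^{p+1}_V\Big\}.$$ With $\chi=\sum_ix_i\partial_i$, $\Omega^p_0(\mathcal{A})=\ker(\iota_\chi:\Omega^p(\mathcal{A})\to\Omega^{p-1}(\mathcal{A}))$; $\Omega^\bullet_0(\mathcal{A})$ is closed under exterior product. $R(m)$ denotes the degree shift, with generator in degree $-m$. For $\lambda\in\mathbb{C}^{\mathcal{A}}$, $\omega_\lambda=\sum_H\lambda_H\frac{d\alpha_H}{\alpha_H}$,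 which lies in $\Omega^1_0(\mathcal{A})$ if $|\lambda|=0$; the complex $(\Omega^\bullet_0(\mathcal{A}),\omega_\lambda)$ has differential $\omega\mapsto\omega_\lambda\wedge\omega$. A pairing $M\times N\to R(m)$ of graded $R$-modules is called non-degenerate if it identifies each of $M,N$ with the $R$-dual $\operatorname{Hom}_R(-,R(m))$ of the other. Self-duality of the complex means that these isomorphisms $\Omega^p_0(\mathcal{A})\cong\operatorname{Hom}_R(\Omega^{\ell-1-p}_0(\mathcal{A}),R(n-\ell))$ identify, up to sign, the complex with its $R(n-\ell)$-dual. *)

theory Defs
  imports
    "HOL-Analysis.Analysis"
    "HOL-Library.Poly_Mapping"
    "HOL-Library.FuncSet"
    "HOL-Computational_Algebra.Polynomial_Factorial"
begin

text \<open>
  The ambient space is \<open>complex ^ 'n\<close> with \<open>'n::{finite,linorder}\<close>, so that \<open>\<ell> = CARD('n)\<close>.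
  The order on \<open>'n\<close> only serves to fix the basis \<open>dx\<^sub>S\<close> of the exterior algebra.
\<close>

type_synonym 'n cvec = "(complex, 'n) vec"

section \<open>Polynomials and rational functions\<close>

type_synonym 'n pring = "('n \<Rightarrow>\<^sub>0 nat) \<Rightarrow>\<^sub>0 complex"

type_synonym 'n ratfun = "'n pring fract"

definition pconst :: "complex \<Rightarrow> ('n::{finite,linorder}) pring" where
  "pconst c = Poly_Mapping.single 0 c"

definition pvar :: "'n \<Rightarrow> ('n::{finite,linorder}) pring" where
  "pvar i = Poly_Mapping.single (Poly_Mapping.single i 1) 1"

definition linear_poly :: "'n cvec \<Rightarrow> ('n::{finite,linorder}) pring" where
  "linear_poly c = (\<Sum>i\<in>UNIV. pconst (c $ i) * pvar i)"

text \<open>Homogeneity with respect to the standard grading; zero is homogeneous of every degree.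
  Degrees are integers, because \<open>1/f\<close> has negative degree and because of the shifts \<open>R(m)\<close>.\<close>

definition poly_hom :: "int \<Rightarrow> ('n::{finite,linorder}) pring \<Rightarrow> bool" where
  "poly_hom d p \<longleftrightarrow>
     (\<forall>t\<in>Poly_Mapping.keys p. int (\<Sum>i\<in>UNIV. Poly_Mapping.lookup t i) = d)"

definition ratfun_hom :: "int \<Rightarrow> ('n::{finite,linorder}) ratfun \<Rightarrow> bool" where
  "ratfun_hom d r \<longleftrightarrow>
     (\<exists>a b i j. b \<noteq> 0 \<and> poly_hom i a \<and> poly_hom j b \<and> d = i - j \<and>
        r = to_fract a / to_fract b)"

section \<open>Rational differential forms\<close>

text \<open>The \<open>S\<close>-component of a form is its coefficient at
  \<open>dx\<^sub>S = dx\<^sub>i\<^sub>1 \<and> \<dots> \<and> dx\<^sub>i\<^sub>p\<close>, where \<open>S = {i\<^sub>1 < \<dots> < i\<^sub>p}\<close>.\<close>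

type_synonym 'n form = "('n ratfun) ^ ('n set)"

definition pscale :: "('n::{finite,linorder}) pring \<Rightarrow> 'n form \<Rightarrow> 'n form"
  where "pscale r \<omega> = to_fract r *s \<omega>"

text \<open>\<open>dx\<^sub>S \<and> dx\<^sub>T = shuffle_sign S T \<cdot> dx\<^sub>S\<^sub>\<union>\<^sub>T\<close> for disjoint \<open>S\<close> and \<open>T\<close>:
  the exponent counts the inversions.\<close>

definition shuffle_sign :: "('n::{finite,linorder}) set \<Rightarrow> 'n set \<Rightarrow> 'n ratfun" where
  "shuffle_sign S T = (- 1) ^ card {(i, j). i \<in> S \<and> j \<in> T \<and> j < i}"

definition wedge :: "('n::{finite,linorder}) form \<Rightarrow> 'n form \<Rightarrow> 'n form" (infixr "\<and>\<^sub>w" 71) where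
  "\<omega> \<and>\<^sub>w \<eta> = (\<chi> U. \<Sum>S\<in>Pow U. shuffle_sign S (U - S) * \<omega> $ S * \<eta> $ (U - S))"

text \<open>Contraction with the Euler field \<open>\<Sum>\<^sub>i x\<^sub>i \<partial>\<^sub>i\<close>:
  \<open>dx\<^sub>S\<close> is sent to the sum over \<open>i \<in> S\<close> of \<open>shuffle_sign {i} (S - {i}) x\<^sub>i dx\<^bsub>S - {i}\<^esub>\<close>.\<close>

definition contract_euler :: "('n::{finite,linorder}) form \<Rightarrow> 'n form" where
  "contract_euler \<omega> =
     (\<chi> T. \<Sum>i\<in>- T. shuffle_sign {i} T * to_fract (pvar i) * \<omega> $ insert i T)"

text \<open>The differential \<open>\<Sum>\<^sub>i c\<^sub>i dx\<^sub>i\<close> of the linear form \<open>linear_poly c\<close>.\<close>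

definition d_linear :: "'n cvec \<Rightarrow> ('n::{finite,linorder}) form" where
  "d_linear c = (\<chi> S. \<Sum>i\<in>UNIV. if S = {i} then to_fract (pconst (c $ i)) else 0)"

text \<open>The grading gives each \<open>dx\<^sub>i\<close> degree 1.\<close>

definition form_hom :: "int \<Rightarrow> ('n::{finite,linorder}) form \<Rightarrow> bool" where
  "form_hom d \<omega> \<longleftrightarrow> (\<forall>S. ratfun_hom (d - int (card S)) (\<omega> $ S))"

definition regular_forms :: "nat \<Rightarrow> ('n::{finite,linorder}) form set" where
  "regular_forms p =
     {\<omega>. (\<forall>S. \<omega> $ S \<in> range to_fract) \<and> (\<forall>S. card S \<noteq> p \<longrightarrow> \<omega> $ S = 0)}"

section \<open>Arrangements and logarithmic forms\<close>

definition linear_kernel :: "('n::finite) cvec \<Rightarrow> 'n cvec set" where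
  "linear_kernel c = {v. (\<Sum>i\<in>UNIV. c $ i * v $ i) = 0}"

definition central_essential_arrangement :: "('n::finite) cvec set set \<Rightarrow> bool" where
  "central_essential_arrangement A \<longleftrightarrow>
     finite A \<and> (\<forall>H\<in>A. \<exists>c. c \<noteq> 0 \<and> H = linear_kernel c) \<and> \<Inter>A = {0}"

text \<open>\<open>\<alpha> H\<close> is the coefficient vector of a linear form with kernel \<open>H\<close>.\<close>

definition defining_forms ::
  "('n::finite) cvec set set \<Rightarrow> ('n cvec set \<Rightarrow> 'n cvec) \<Rightarrow> bool" where
  "defining_forms A \<alpha> \<longleftrightarrow> (\<forall>H\<in>A. \<alpha> H \<noteq> 0 \<and> H = linear_kernel (\<alpha> H))"

definition defining_poly ::
  "'n cvec set set \<Rightarrow> ('n cvec set \<Rightarrow> 'n cvec) \<Rightarrow> ('n::{finite,linorder}) pring"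
  where "defining_poly A \<alpha> = (\<Prod>H\<in>A. linear_poly (\<alpha> H))"

definition polar_forms ::
  "'n cvec set set \<Rightarrow> ('n cvec set \<Rightarrow> 'n cvec) \<Rightarrow> nat
    \<Rightarrow> ('n::{finite,linorder}) form set"
  where "polar_forms A \<alpha> p =
    (\<lambda>\<eta>. inverse (to_fract (defining_poly A \<alpha>)) *s \<eta>) ` regular_forms p"

definition dlog :: "'n cvec \<Rightarrow> ('n::{finite,linorder}) form" where
  "dlog c = inverse (to_fract (linear_poly c)) *s d_linear c"

definition log_forms ::
  "'n cvec set set \<Rightarrow> ('n cvec set \<Rightarrow> 'n cvec) \<Rightarrow> nat
    \<Rightarrow> ('n::{finite,linorder}) form set"
  where "log_forms A \<alpha> p =
    {\<omega> \<in> polar_forms A \<alpha> p. \<forall>H\<in>A. dlog (\<alpha> H) \<and>\<^sub>w \<omega> \<in> polar_forms A \<alpha> (Suc p)}"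

definition log_forms0 ::
  "'n cvec set set \<Rightarrow> ('n cvec set \<Rightarrow> 'n cvec) \<Rightarrow> nat
    \<Rightarrow> ('n::{finite,linorder}) form set"
  where "log_forms0 A \<alpha> p = {\<omega> \<in> log_forms A \<alpha> p. contract_euler \<omega> = 0}"

definition omega_weight ::
  "'n cvec set set \<Rightarrow> ('n cvec set \<Rightarrow> 'n cvec) \<Rightarrow>
    ('n cvec set \<Rightarrow> complex) \<Rightarrow> ('n::{finite,linorder}) form"
  where "omega_weight A \<alpha> lam = (\<Sum>H\<in>A. pscale (pconst (lam H)) (dlog (\<alpha> H)))"

section \<open>Graded modules of forms and their duals\<close>

definition graded_submodule :: "('n::{finite,linorder}) form set \<Rightarrow> bool" where
  "graded_submodule M \<longleftrightarrow>
     0 \<in> M \<and>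
     (\<forall>\<omega>\<in>M. \<forall>\<eta>\<in>M. \<omega> + \<eta> \<in> M) \<and>
     (\<forall>r. \<forall>\<omega>\<in>M. pscale r \<omega> \<in> M) \<and>
     (\<forall>\<omega>\<in>M. \<exists>D c. finite D \<and> (\<forall>d\<in>D. c d \<in> M \<and> form_hom d (c d)) \<and> \<omega> = (\<Sum>d\<in>D. c d))"

definition R_linear_on ::
  "('n::{finite,linorder}) form set \<Rightarrow> ('n form \<Rightarrow> 'n pring) \<Rightarrow> bool" where
  "R_linear_on M \<phi> \<longleftrightarrow>
     (\<forall>\<omega>\<in>M. \<forall>\<eta>\<in>M. \<phi> (\<omega> + \<eta>) = \<phi> \<omega> + \<phi> \<eta>) \<and>
     (\<forall>r. \<forall>\<omega>\<in>M. \<phi> (pscale r \<omega>) = r * \<phi> \<omega>)"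

text \<open>The underlying set of \<open>Hom\<^sub>R(M, R(m))\<close>, which does not depend on \<open>m\<close>; maps are made
  extensional so that they are determined by their values on \<open>M\<close>.\<close>

definition dual_module :: "('n::{finite,linorder}) form set \<Rightarrow> ('n form \<Rightarrow> 'n pring) set" where
  "dual_module M = {\<phi> \<in> extensional M. R_linear_on M \<phi>}"

text \<open>\<open>\<phi>\<close> is homogeneous of degree \<open>d\<close> as an element of \<open>Hom\<^sub>R(M, R(m))\<close>.
  Recall that \<open>R(m)\<close> has degree-\<open>e\<close> part \<open>R\<^bsub>m + e\<^esub>\<close>.\<close>

definition dual_hom ::
  "('n::{finite,linorder}) form set \<Rightarrow> int \<Rightarrow> int \<Rightarrow> ('n form \<Rightarrow> 'n pring) \<Rightarrow> bool" where
  "dual_hom M m d \<phi> \<longleftrightarrow> (\<forall>e. \<forall>\<omega>\<in>M. form_hom e \<omega> \<longrightarrow> poly_hom (m + (d + e)) (\<phi> \<omega>))"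

definition graded_iso_shift ::
  "('n::{finite,linorder}) form set \<Rightarrow> int \<Rightarrow> ('n form \<Rightarrow> 'n pring) \<Rightarrow> bool" where
  "graded_iso_shift M m \<psi> \<longleftrightarrow>
     R_linear_on M \<psi> \<and> bij_betw \<psi> M UNIV \<and>
     (\<forall>d. \<forall>\<omega>\<in>M. form_hom d \<omega> \<longleftrightarrow> poly_hom (m + d) (\<psi> \<omega>))"

text \<open>\<open>\<Phi>\<close> is an isomorphism of graded modules from \<open>M\<close> to \<open>Hom\<^sub>R(N, R(m))\<close>.\<close>

definition graded_iso_dual ::
  "('n::{finite,linorder}) form set \<Rightarrow> 'n form set \<Rightarrow> int
    \<Rightarrow> ('n form \<Rightarrow> 'n form \<Rightarrow> 'n pring) \<Rightarrow> bool" where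
  "graded_iso_dual M N m \<Phi> \<longleftrightarrow>
     (\<forall>\<eta>\<in>N. R_linear_on M (\<lambda>\<omega>. \<Phi> \<omega> \<eta>)) \<and>
     bij_betw \<Phi> M (dual_module N) \<and>
     (\<forall>d. \<forall>\<omega>\<in>M. form_hom d \<omega> \<longleftrightarrow> dual_hom N m d (\<Phi> \<omega>))"

definition graded_pairing ::
  "('n::{finite,linorder}) form set \<Rightarrow> 'n form set \<Rightarrow> int
    \<Rightarrow> ('n form \<Rightarrow> 'n form \<Rightarrow> 'n pring) \<Rightarrow> bool" where
  "graded_pairing M N m B \<longleftrightarrow>
     graded_submodule M \<and> graded_submodule N \<and>
     (\<forall>\<omega>\<in>M. R_linear_on N (B \<omega>)) \<and>
     (\<forall>\<eta>\<in>N. R_linear_on M (\<lambda>\<omega>. B \<omega> \<eta>)) \<and>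
     (\<forall>d e. \<forall>\<omega>\<in>M. \<forall>\<eta>\<in>N. form_hom d \<omega> \<longrightarrow> form_hom e \<eta> \<longrightarrow> poly_hom (m + (d + e)) (B \<omega> \<eta>))"

definition nondegenerate_pairing ::
  "('n::{finite,linorder}) form set \<Rightarrow> 'n form set \<Rightarrow> int
    \<Rightarrow> ('n form \<Rightarrow> 'n form \<Rightarrow> 'n pring) \<Rightarrow> bool" where
  "nondegenerate_pairing M N m B \<longleftrightarrow>
     graded_pairing M N m B \<and>
     graded_iso_dual M N m (\<lambda>\<omega>. restrict (\<lambda>\<eta>. B \<omega> \<eta>) N) \<and>
     graded_iso_dual N M m (\<lambda>\<eta>. restrict (\<lambda>\<omega>. B \<omega> \<eta>) M)"

text \<open>\<open>C\<close> with differential \<open>d\<close> is a complex of graded modules in cohomological degrees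
  \<open>0, \<dots>, k\<close>.\<close>

definition graded_complex ::
  "nat \<Rightarrow> (nat \<Rightarrow> ('n::{finite,linorder}) form set) \<Rightarrow> ('n form \<Rightarrow> 'n form) \<Rightarrow> bool" where
  "graded_complex k C d \<longleftrightarrow>
     (\<forall>p. graded_submodule (C p)) \<and> (\<forall>p>k. C p = {0}) \<and>
     (\<forall>p. \<forall>\<omega>\<in>C p.
        d \<omega> \<in> C (Suc p) \<and> d (d \<omega>) = 0 \<and>
        (\<forall>\<eta>\<in>C p. d (\<omega> + \<eta>) = d \<omega> + d \<eta>) \<and>
        (\<forall>r. d (pscale r \<omega>) = pscale r (d \<omega>)) \<and>
        (\<forall>e. form_hom e \<omega> \<longrightarrow> form_hom e (d \<omega>)))"

text \<open>The \<open>R(m)\<close>-dual of such a complex has \<open>Hom\<^sub>R(C\<^bsub>k - p\<^esub>, R(m))\<close> in degree \<open>p\<close>, and its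
  differential is precomposition with \<open>d\<close>. The isomorphisms \<open>\<Phi> p\<close> have to commute with the
  differentials up to a sign which may depend on \<open>p\<close> only.\<close>

definition self_dual_via ::
  "nat \<Rightarrow> (nat \<Rightarrow> ('n::{finite,linorder}) form set) \<Rightarrow> ('n form \<Rightarrow> 'n form) \<Rightarrow> int
    \<Rightarrow> (nat \<Rightarrow> 'n form \<Rightarrow> 'n form \<Rightarrow> 'n pring) \<Rightarrow> bool" where
  "self_dual_via k C d m \<Phi> \<longleftrightarrow>
     graded_complex k C d \<and>
     (\<forall>p\<le>k. graded_iso_dual (C p) (C (k - p)) m (\<Phi> p)) \<and>
     (\<forall>p<k. \<exists>s\<in>{1, -1}. \<forall>\<omega>\<in>C p.
        \<Phi> (Suc p) (d \<omega>) = restrict (\<lambda>\<eta>. s * \<Phi> p \<omega> (d \<eta>)) (C (k - Suc p)))"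

end

theory Submission
  imports Defs
begin

text \<open>Write \<open>f\<close> for the defining polynomial, which is \<open>Q\<close> when regarded as a rational function, \<open>\<iota>\<close> for
  contraction with the Euler field, \<open>vol\<close> for \<open>dx\<^sub>1 \<and> \<dots> \<and> dx\<^sub>\<ell>\<close>, and \<open>C p\<close> for \<open>\<Omega>\<^sup>p\<^sub>0(A)\<close>. The proof
  rests on three observations.

  First, \<open>\<iota>\<close> is an antiderivation with square zero and \<open>\<iota>(d\<alpha>\<^sub>H/\<alpha>\<^sub>H) = 1\<close>. Hence wedging with
  \<open>d\<alpha>\<^sub>H/\<alpha>\<^sub>H\<close> is a homotopy that makes \<open>\<iota>\<close> exact on logarithmic forms: every \<open>\<omega>\<close> in \<open>C p\<close> equals
  \<open>\<iota>(d\<alpha>\<^sub>H/\<alpha>\<^sub>H \<and> \<omega>)\<close> (\<open>C_eq_contract_dlog\<close>). In top degree this shows that \<open>C (\<ell> - 1)\<close> is free on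
  \<open>\<iota>(vol)/f\<close>, which has degree \<open>\<ell> - n\<close> (\<open>C_top_generated\<close>).

  Second, logarithmic forms are closed under the exterior product. For one hyperplane, contraction
  with a constant vector \<open>v\<close> with \<open>\<alpha>\<^sub>H(v) = 1\<close> splits \<open>\<omega>\<close> into a part that has no pole along \<open>H\<close> and a
  multiple of \<open>d\<alpha>\<^sub>H\<close>; so a product has at most a simple pole along \<open>H\<close>. As the \<open>\<alpha>\<^sub>H\<close> are pairwise
  non-associated primes, these bounds combine to the denominator \<open>f\<close> (\<open>log_forms_wedge\<close>).

  Third, if \<open>p + q = \<ell> - 1\<close> and \<open>\<iota>(\<omega>) = 0\<close>, then \<open>\<omega> \<and> \<iota>(\<zeta>)\<close> is, up to sign, \<open>\<iota>\<close> of the top form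
  \<open>\<omega> \<and> \<zeta>\<close>, so it only sees one coefficient (\<open>wedge_contract_euler_top\<close>). For \<open>\<zeta> = dx\<^sub>T\<close>
  this coefficient is, up to sign, a coefficient of \<open>\<omega>\<close>. Therefore the pairing with the forms
  \<open>\<iota>(dx\<^sub>T)\<close>, which lie in \<open>C q\<close>, detects whether \<open>\<omega>\<close> vanishes and whether it is homogeneous.
  Conversely, a linear functional
  \<open>\<phi>\<close> on \<open>C q\<close> prescribes the coefficients of a form \<open>\<omega>\<close> with denominator \<open>f\<close> through the values
  \<open>\<phi>(\<iota>(dx\<^sub>T))\<close>, and its values at \<open>\<iota>(d\<alpha>\<^sub>H/\<alpha>\<^sub>H \<and> dx\<^sub>T)\<close> bound the coefficients of
  \<open>d\<alpha>\<^sub>H/\<alpha>\<^sub>H \<and> \<omega>\<close> in the same way. So \<open>\<omega>\<close> is logarithmic, and it represents \<open>\<phi>\<close>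
  (\<open>wedge_pairing_surjective\<close>).

  The second half of non-degeneracy is the first one with the factors exchanged, which costs a
  sign. Self-duality follows because \<open>\<omega>\<^sub>\<lambda>\<close> lies in \<open>C 1\<close> when the weights sum to zero and can be
  moved across \<open>\<omega>\<close> in \<open>\<omega>\<^sub>\<lambda> \<and> \<omega> \<and> \<eta>\<close>, again up to sign.\<close>

section \<open>The exterior algebra over the field of rational functions\<close>

text \<open>In this form the sign is visibly multiplicative in both arguments, and that is all that
  associativity and the Leibniz rule need to know about it.\<close>

lemma shuffle_sign_prod:
  "shuffle_sign S T = (\<Prod>i\<in>S. \<Prod>j\<in>T. if j < i then - 1 else 1)"
proof -
  have "card {(i, j). i \<in> S \<and> j \<in> T \<and> j < i} = card (SIGMA i:S. {j \<in> T. j < i})"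
    by (rule arg_cong[where f = card]) auto
  also have "\<dots> = (\<Sum>i\<in>S. card {j \<in> T. j < i})"
    by (rule card_SigmaI) auto
  finally have "shuffle_sign S T = (\<Prod>i\<in>S. (- 1) ^ card {j \<in> T. j < i})"
    by (simp add: shuffle_sign_def power_sum)
  also have "\<dots> = (\<Prod>i\<in>S. \<Prod>j\<in>T. if j < i then - 1 else 1)"
    by (intro prod.cong refl) (simp add: prod.If_cases Int_def)
  finally show ?thesis .
qed

lemma shuffle_sign_empty [simp]: "shuffle_sign {} T = 1" "shuffle_sign S {} = 1"
  by (simp_all add: shuffle_sign_prod)

lemma shuffle_sign_union_left:
  "S \<inter> S' = {} \<Longrightarrow> shuffle_sign (S \<union> S') T = shuffle_sign S T * shuffle_sign S' T"
  by (simp add: shuffle_sign_prod prod.union_disjoint)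

lemma shuffle_sign_union_right:
  "T \<inter> T' = {} \<Longrightarrow> shuffle_sign S (T \<union> T') = shuffle_sign S T * shuffle_sign S T'"
  by (simp add: shuffle_sign_prod prod.union_disjoint prod.distrib)

lemma shuffle_sign_square [simp]: "shuffle_sign S T * shuffle_sign S T = 1"
  by (simp add: shuffle_sign_def flip: power_mult_distrib)

lemma shuffle_sign_nonzero [simp]: "shuffle_sign S T \<noteq> 0"
  by (simp add: shuffle_sign_def)

lemma shuffle_sign_swap:
  assumes "S \<inter> T = {}"
  shows "shuffle_sign S T = (- 1) ^ (card S * card T) * shuffle_sign T S"
proof -
  have "shuffle_sign S T * shuffle_sign T S =
      (\<Prod>i\<in>S. \<Prod>j\<in>T. (if j < i then - 1 else 1) * (if i < j then - 1 else 1))"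
    unfolding shuffle_sign_prod[of T S] prod.swap[of _ S T] shuffle_sign_prod[of S T]
    by (simp add: prod.distrib)
  also have "\<dots> = (\<Prod>i\<in>S. \<Prod>j\<in>T. - 1)"
    using assms by (intro prod.cong refl) (auto simp: disjoint_iff dest: less_asym)
  also have "\<dots> = (- 1) ^ (card S * card T)"
    by (simp add: mult.commute flip: power_mult)
  finally have "shuffle_sign S T * shuffle_sign T S * shuffle_sign T S =
      (- 1) ^ (card S * card T) * shuffle_sign T S"
    by simp
  then show ?thesis by (simp add: mult.assoc)
qed

definition dx :: "'n set \<Rightarrow> ('n::{finite,linorder}) form" where
  "dx S = axis S 1"

lemma dx_component: "dx S $ T = (if T = S then 1 else 0)"
  by (simp add: dx_def axis_def)

lemma form_expansion: "(\<omega> :: ('n::{finite,linorder}) form) = (\<Sum>S\<in>UNIV. \<omega> $ S *s dx S)"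
  unfolding dx_def by (rule basis_expansion[symmetric])

text \<open>Identities which are linear in a form need only be checked on the forms \<open>dx\<^sub>S\<close>.\<close>

lemma form_linear_induct [case_names zero add scale dx]:
  fixes \<omega> :: "('n::{finite,linorder}) form"
  assumes "P 0" "\<And>a b. P a \<Longrightarrow> P b \<Longrightarrow> P (a + b)" "\<And>c a. P a \<Longrightarrow> P (c *s a)" "\<And>S. P (dx S)"
  shows "P \<omega>"
proof -
  have "P (\<Sum>S\<in>F. \<omega> $ S *s dx S)" for F :: "'n set set"
    by (induction F rule: infinite_finite_induct) (auto intro: assms)
  from this[of UNIV] form_expansion[of \<omega>] show ?thesis by simp
qed

lemma wedge_component:
  "(\<omega> \<and>\<^sub>w \<eta>) $ U = (\<Sum>S\<in>Pow U. shuffle_sign S (U - S) * \<omega> $ S * \<eta> $ (U - S))"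
  by (simp add: wedge_def)

lemma wedge_add_left: "(a + b) \<and>\<^sub>w c = a \<and>\<^sub>w c + b \<and>\<^sub>w c"
  and wedge_add_right: "a \<and>\<^sub>w (b + c) = a \<and>\<^sub>w b + a \<and>\<^sub>w c"
  and wedge_scale_left: "(r *s a) \<and>\<^sub>w b = r *s a \<and>\<^sub>w b"
  and wedge_scale_right: "a \<and>\<^sub>w (r *s b) = r *s a \<and>\<^sub>w b"
  and wedge_zero_left [simp]: "0 \<and>\<^sub>w b = 0"
  and wedge_zero_right [simp]: "a \<and>\<^sub>w 0 = 0"
  and wedge_minus_left [simp]: "(- a) \<and>\<^sub>w b = - (a \<and>\<^sub>w b)"
  by (simp_all add: vec_eq_iff wedge_component sum.distrib sum_distrib_left sum_negf algebra_simps)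

lemma wedge_sum_right: "a \<and>\<^sub>w (\<Sum>i\<in>I. g i) = (\<Sum>i\<in>I. a \<and>\<^sub>w g i)"
  by (induction I rule: infinite_finite_induct) (simp_all add: wedge_add_right)

lemma wedge_dx:
  "dx S \<and>\<^sub>w dx T = (if S \<inter> T = {} then shuffle_sign S T *s dx (S \<union> T) else 0)"
proof -
  have "(dx S \<and>\<^sub>w dx T) $ U = (if S \<inter> T = {} then shuffle_sign S T *s dx (S \<union> T) else 0) $ U" for U
  proof -
    have "(dx S \<and>\<^sub>w dx T) $ U = (\<Sum>X\<in>Pow U. if X = S then (if U - S = T then shuffle_sign S T else 0) else 0)"
      unfolding wedge_component by (intro sum.cong) (auto simp: dx_component)
    also have "\<dots> = (if S \<subseteq> U then (if U - S = T then shuffle_sign S T else 0) else 0)"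
      by (subst sum.delta) auto
    also have "\<dots> = (if S \<inter> T = {} then shuffle_sign S T *s dx (S \<union> T) else 0) $ U"
      by (auto simp: dx_component)
    finally show ?thesis .
  qed
  then show ?thesis by (simp add: vec_eq_iff)
qed

lemma wedge_dx_empty [simp]: "dx {} \<and>\<^sub>w \<omega> = \<omega>" "\<omega> \<and>\<^sub>w dx {} = \<omega>"
  by (induction \<omega> rule: form_linear_induct)
    (simp_all add: wedge_dx wedge_add_left wedge_add_right wedge_scale_left wedge_scale_right)

text \<open>On basis forms, both sides carry the product of the three pairwise shuffle signs.\<close>

lemma wedge_assoc: "(a \<and>\<^sub>w b) \<and>\<^sub>w c = a \<and>\<^sub>w b \<and>\<^sub>w c"
proof (induction a rule: form_linear_induct)
  case (dx S)
  show ?case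
  proof (induction b rule: form_linear_induct)
    case (dx T)
    show ?case
    proof (induction c rule: form_linear_induct)
      case (dx U)
      show ?case
        by (auto simp: wedge_dx wedge_scale_left wedge_scale_right shuffle_sign_union_left
            shuffle_sign_union_right Un_assoc Int_Un_distrib Int_Un_distrib2 ac_simps)
    qed (simp_all add: wedge_add_right wedge_scale_right)
  qed (simp_all add: wedge_add_left wedge_add_right wedge_scale_left wedge_scale_right)
qed (simp_all add: wedge_add_left wedge_scale_left)

definition of_degree :: "nat \<Rightarrow> ('n::{finite,linorder}) form \<Rightarrow> bool" where
  "of_degree p \<omega> \<longleftrightarrow> (\<forall>S. card S \<noteq> p \<longrightarrow> \<omega> $ S = 0)"

lemma of_degreeD: "of_degree p \<omega> \<Longrightarrow> card S \<noteq> p \<Longrightarrow> \<omega> $ S = 0"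
  by (simp add: of_degree_def)

lemma of_degree_wedge:
  assumes "of_degree p \<omega>" "of_degree q \<eta>"
  shows "of_degree (p + q) (\<omega> \<and>\<^sub>w \<eta>)"
  unfolding of_degree_def wedge_component
proof (intro allI impI sum.neutral ballI)
  fix U S :: "'a set" assume U: "card U \<noteq> p + q" and S: "S \<in> Pow U"
  then have "card U = card S + card (U - S)"
    by (metis Pow_iff card_Diff_subset card_mono finite le_add_diff_inverse)
  with U have "card S \<noteq> p \<or> card (U - S) \<noteq> q" by auto
  then show "shuffle_sign S (U - S) * \<omega> $ S * \<eta> $ (U - S) = 0"
    using assms by (auto simp: of_degree_def)
qed

lemma wedge_graded_commute:
  assumes "of_degree p \<omega>" "of_degree q \<eta>"
  shows "\<omega> \<and>\<^sub>w \<eta> = (- 1) ^ (p * q) *s \<eta> \<and>\<^sub>w \<omega>"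
proof -
  have "(\<omega> \<and>\<^sub>w \<eta>) $ U = ((- 1) ^ (p * q) *s \<eta> \<and>\<^sub>w \<omega>) $ U" for U
  proof -
    have "(\<omega> \<and>\<^sub>w \<eta>) $ U = (\<Sum>S\<in>Pow U. shuffle_sign (U - S) S * \<omega> $ (U - S) * \<eta> $ S)"
      unfolding wedge_component
      by (rule sum.reindex_bij_witness[of _ "\<lambda>S. U - S" "\<lambda>S. U - S"]) (auto simp: double_diff)
    also have "\<dots> = (\<Sum>S\<in>Pow U. (- 1) ^ (p * q) * (shuffle_sign S (U - S) * \<eta> $ S * \<omega> $ (U - S)))"
    proof (intro sum.cong refl)
      fix S assume "S \<in> Pow U"
      have "shuffle_sign (U - S) S = (- 1) ^ (card (U - S) * card S) * shuffle_sign S (U - S)"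
        by (rule shuffle_sign_swap) auto
      then show "shuffle_sign (U - S) S * \<omega> $ (U - S) * \<eta> $ S =
          (- 1) ^ (p * q) * (shuffle_sign S (U - S) * \<eta> $ S * \<omega> $ (U - S))"
        using of_degreeD[OF assms(1), of "U - S"] of_degreeD[OF assms(2), of S]
        by (cases "card (U - S) = p \<and> card S = q") auto
    qed
    finally show ?thesis by (simp add: wedge_component sum_distrib_left)
  qed
  then show ?thesis by (simp add: vec_eq_iff)
qed

lemma of_degree_one_square_zero:
  assumes "of_degree 1 a"
  shows "a \<and>\<^sub>w a = 0"
proof -
  \<comment> \<open>A one-form anticommutes with itself, and \<open>2\<close> is invertible.\<close>
  have "a \<and>\<^sub>w a = - (a \<and>\<^sub>w a)"
    using wedge_graded_commute[OF assms assms] by simp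
  then have "2 * (a \<and>\<^sub>w a) $ U = 0" for U
    by (metis add.right_inverse mult_2 vector_add_component zero_index)
  moreover have "(2 :: 'a ratfun) \<noteq> 0"
    by (metis of_nat_numeral of_nat_eq_0_iff to_fract_0 to_fract_eq_iff zero_neq_numeral to_fract_1 to_fract_add one_add_one)
  ultimately show ?thesis by (simp add: vec_eq_iff)
qed

subsection \<open>Contraction with a vector field\<close>

text \<open>Contraction with \<open>\<Sum>\<^sub>i w\<^sub>i \<partial>\<^sub>i\<close>. Besides the Euler field, constant vector fields are used, in order
  to split forms along a hyperplane.\<close>

definition contract :: "('n \<Rightarrow> 'n ratfun) \<Rightarrow> ('n::{finite,linorder}) form \<Rightarrow> 'n form" where
  "contract w \<omega> = (\<chi> T. \<Sum>i\<in>- T. shuffle_sign {i} T * w i * \<omega> $ insert i T)"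

lemma contract_euler_contract: "contract_euler = contract (\<lambda>i. to_fract (pvar i))"
  by (simp add: fun_eq_iff contract_euler_def contract_def)

lemma contract_component:
  "contract w \<omega> $ T = (\<Sum>i\<in>- T. shuffle_sign {i} T * w i * \<omega> $ insert i T)"
  by (simp add: contract_def)

lemma contract_add: "contract w (a + b) = contract w a + contract w b"
  and contract_scale: "contract w (r *s a) = r *s contract w a"
  and contract_zero [simp]: "contract w 0 = 0"
  and contract_diff: "contract w (a - b) = contract w a - contract w b"
  by (simp_all add: vec_eq_iff contract_component sum.distrib sum_subtractf sum_distrib_left algebra_simps)

lemma contract_sum: "contract w (\<Sum>i\<in>I. g i) = (\<Sum>i\<in>I. contract w (g i))"
  by (induction I rule: infinite_finite_induct) (simp_all add: contract_add)

lemma contract_dx: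
  "contract w (dx S) = (\<Sum>i\<in>S. (shuffle_sign {i} (S - {i}) * w i) *s dx (S - {i}))"
proof -
  have "contract w (dx S) $ T = (\<Sum>i\<in>S. (shuffle_sign {i} (S - {i}) * w i) *s dx (S - {i})) $ T" for T
  proof -
    have "contract w (dx S) $ T = (\<Sum>i\<in>{i \<in> - T. insert i T = S}. shuffle_sign {i} T * w i)"
      unfolding contract_component by (rule sum.mono_neutral_cong_right) (auto simp: dx_component)
    also have "\<dots> = (\<Sum>i\<in>{i \<in> S. S - {i} = T}. shuffle_sign {i} (S - {i}) * w i)"
      by (intro sum.cong) auto
    also have "\<dots> = (\<Sum>i\<in>S. (shuffle_sign {i} (S - {i}) * w i) *s dx (S - {i})) $ T"
      unfolding sum_component by (rule sum.mono_neutral_cong_left) (auto simp: dx_component)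
    finally show ?thesis .
  qed
  then show ?thesis by (simp add: vec_eq_iff)
qed

lemma of_degree_contract: "of_degree (Suc p) \<omega> \<Longrightarrow> of_degree p (contract w \<omega>)"
  by (auto simp: of_degree_def contract_component intro!: sum.neutral)

text \<open>Multiplication by \<open>(- 1)\<^sup>p\<close> in degree \<open>p\<close>. With it the Leibniz rule makes sense for forms of mixed
  degree, so that it can be proved by linearity.\<close>

definition grade_involution :: "('n::{finite,linorder}) form \<Rightarrow> 'n form" where
  "grade_involution \<omega> = (\<chi> S. (- 1) ^ card S * \<omega> $ S)"

lemma grade_involution_add: "grade_involution (a + b) = grade_involution a + grade_involution b"
  and grade_involution_scale: "grade_involution (r *s a) = r *s grade_involution a"
  and grade_involution_zero [simp]: "grade_involution 0 = 0"
  and grade_involution_dx: "grade_involution (dx S) = (- 1) ^ card S *s dx S"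
  by (simp_all add: vec_eq_iff grade_involution_def algebra_simps dx_component)

lemma grade_involution_of_degree: "of_degree p \<omega> \<Longrightarrow> grade_involution \<omega> = (- 1) ^ p *s \<omega>"
  by (auto simp: vec_eq_iff grade_involution_def of_degree_def)

lemma grade_involution_wedge:
  "grade_involution (a \<and>\<^sub>w b) = grade_involution a \<and>\<^sub>w grade_involution b"
proof (induction a rule: form_linear_induct)
  case (dx S)
  show ?case
  proof (induction b rule: form_linear_induct)
    case (dx T)
    show ?case
      by (auto simp: wedge_dx wedge_scale_left wedge_scale_right grade_involution_dx
          grade_involution_scale card_Un_disjoint power_add ac_simps)
  qed (simp_all add: wedge_add_right wedge_scale_right grade_involution_add grade_involution_scale)
qed (simp_all add: wedge_add_left wedge_scale_left grade_involution_add grade_involution_scale)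

text \<open>Properties that pass to exterior products, such as the Leibniz rule, need only be checked on
  the generators \<open>dx\<^sub>i\<close> of the algebra.\<close>

lemma form_algebra_induct [case_names zero add scale one gen wedge]:
  fixes \<omega> :: "('n::{finite,linorder}) form"
  assumes "P 0" "\<And>a b. P a \<Longrightarrow> P b \<Longrightarrow> P (a + b)" "\<And>c a. P a \<Longrightarrow> P (c *s a)"
    and "P (dx {})" "\<And>i. P (dx {i})" "\<And>a b. P a \<Longrightarrow> P b \<Longrightarrow> P (a \<and>\<^sub>w b)"
  shows "P \<omega>"
proof (induction \<omega> rule: form_linear_induct)
  case (dx S)
  have "finite S" by simp
  then show ?case
  proof (induction S rule: finite_induct)
    case (insert i S)
    have "dx (insert i S) = shuffle_sign {i} S *s (dx {i} \<and>\<^sub>w dx S)"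
      using insert.hyps by (simp add: wedge_dx)
    with insert assms show ?case by simp
  qed (rule assms)
qed (use assms in auto)

text \<open>On \<open>dx\<^sub>T\<close> with \<open>i \<in> T\<close> the left side vanishes, and on the right only the summand that removes
  \<open>dx\<^sub>i\<close> survives. If \<open>i \<notin> T\<close>, the summands that remove some \<open>j \<in> T\<close> agree up to the sign for
  exchanging \<open>dx\<^sub>i\<close> and \<open>dx\<^sub>j\<close>.\<close>

lemma contract_wedge_gen:
  "contract w (dx {i} \<and>\<^sub>w b) = w i *s b - dx {i} \<and>\<^sub>w contract w b"
proof (induction b rule: form_linear_induct)
  case (dx T)
  show ?case
  proof (cases "i \<in> T")
    case True
    have "dx {i} \<and>\<^sub>w contract w (dx T) =
        (\<Sum>j\<in>T. if j = i then w i *s dx T else 0)"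
      unfolding contract_dx wedge_sum_right wedge_scale_right using True
      by (intro sum.cong) (auto simp: wedge_dx insert_absorb ac_simps)
    with True show ?thesis by (simp add: wedge_dx)
  next
    case False
    have "contract w (dx {i} \<and>\<^sub>w dx T) = shuffle_sign {i} T *s contract w (dx (insert i T))"
      using False by (simp add: wedge_dx contract_scale)
    also have "contract w (dx (insert i T)) = (shuffle_sign {i} T * w i) *s dx T +
        (\<Sum>j\<in>T. (shuffle_sign {j} (insert i T - {j}) * w j) *s dx (insert i T - {j}))"
      using False by (simp add: contract_dx)
    also have "shuffle_sign {i} T *s \<dots> = w i *s dx T +
        (\<Sum>j\<in>T. shuffle_sign {i} T *s ((shuffle_sign {j} (insert i T - {j}) * w j) *s dx (insert i T - {j})))"
      by (simp add: vector_ssub_ldistrib vector_add_ldistrib vec.scale_sum_right mult.assoc[symmetric])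
    also have "(\<Sum>j\<in>T. shuffle_sign {i} T *s ((shuffle_sign {j} (insert i T - {j}) * w j) *s dx (insert i T - {j})))
      = (\<Sum>j\<in>T. - ((shuffle_sign {j} (T - {j}) * w j) *s (dx {i} \<and>\<^sub>w dx (T - {j}))))"
    proof (intro sum.cong refl)
      fix j assume j: "j \<in> T"
      have 1: "shuffle_sign {i} T = shuffle_sign {i} {j} * shuffle_sign {i} (T - {j})"
        using shuffle_sign_union_right[of "{j}" "T - {j}" "{i}"] j by (simp add: insert_absorb)
      have e: "insert i T - {j} = {i} \<union> (T - {j})" using j False by auto
      have 2: "shuffle_sign {j} (insert i T - {j}) = shuffle_sign {j} {i} * shuffle_sign {j} (T - {j})"
        unfolding e using False by (intro shuffle_sign_union_right) auto
      have "shuffle_sign {i} {j} = - shuffle_sign {j} {i}"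
        using shuffle_sign_swap[of "{i}" "{j}"] j False by auto
      then have 3: "shuffle_sign {i} {j} * shuffle_sign {j} {i} = - 1" by simp
      have 4: "shuffle_sign {i} T * shuffle_sign {j} (insert i T - {j}) =
          - (shuffle_sign {i} (T - {j}) * shuffle_sign {j} (T - {j}))"
      proof -
        have "shuffle_sign {i} T * shuffle_sign {j} (insert i T - {j}) =
          (shuffle_sign {i} {j} * shuffle_sign {j} {i}) * (shuffle_sign {i} (T - {j}) * shuffle_sign {j} (T - {j}))"
          unfolding 1 2 by (simp only: ac_simps)
        then show ?thesis by (simp only: 3 mult_minus1)
      qed
      show "shuffle_sign {i} T *s ((shuffle_sign {j} (insert i T - {j}) * w j) *s dx (insert i T - {j})) =
        - ((shuffle_sign {j} (T - {j}) * w j) *s (dx {i} \<and>\<^sub>w dx (T - {j})))"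
        using False j 4 e by (simp add: wedge_dx mult.assoc[symmetric])
    qed
    finally show ?thesis
      by (simp add: contract_dx wedge_sum_right wedge_scale_right sum_negf)
  qed
next
  case (scale c a)
  then show ?case
    by (simp add: wedge_scale_right contract_scale vec.scale_right_diff_distrib mult.commute)
qed (simp_all add: wedge_add_right contract_add vector_add_ldistrib)

lemma contract_wedge:
  "contract w (a \<and>\<^sub>w b) = contract w a \<and>\<^sub>w b + grade_involution a \<and>\<^sub>w contract w b"
proof (induction a arbitrary: b rule: form_algebra_induct)
  case one
  show ?case by (simp add: contract_dx grade_involution_dx)
next
  case (gen i)
  show ?case
    by (simp add: contract_wedge_gen contract_dx grade_involution_dx wedge_scale_left)
next
  case (wedge a a')
  show ?case
    by (simp add: wedge_assoc wedge wedge_add_left wedge_add_right grade_involution_wedge)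
qed (simp_all add: wedge_add_left wedge_scale_left contract_add contract_scale
    grade_involution_add grade_involution_scale vector_add_ldistrib)

lemma contract_contract [simp]: "contract w (contract w a) = 0"
proof (induction a rule: form_linear_induct)
  case (dx S)
  have "finite S" by simp
  then show ?case
  proof (induction S rule: finite_induct)
    case (insert i S)
    have "dx (insert i S) = shuffle_sign {i} S *s (dx {i} \<and>\<^sub>w dx S)"
      using insert.hyps by (simp add: wedge_dx)
    with insert show ?case
      by (simp add: contract_scale contract_diff contract_wedge_gen)
  qed (simp add: contract_dx)
qed (simp_all add: contract_add contract_scale)

section \<open>Linear forms in the polynomial ring\<close>

lemma pring_sum_monomials: "p = (\<Sum>t\<in>Poly_Mapping.keys p. Poly_Mapping.single t (Poly_Mapping.lookup p t))"
proof (rule poly_mapping_eqI)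
  fix t
  show "Poly_Mapping.lookup p t =
      Poly_Mapping.lookup (\<Sum>t\<in>Poly_Mapping.keys p. Poly_Mapping.single t (Poly_Mapping.lookup p t)) t"
    by (simp add: lookup_sum lookup_single when_def in_keys_iff)
qed

lemma monomial_eq_prod_pvar:
  fixes t :: "'n::{finite,linorder} \<Rightarrow>\<^sub>0 nat"
  shows "Poly_Mapping.single t c = pconst c * (\<Prod>i\<in>UNIV. pvar i ^ Poly_Mapping.lookup t i)"
proof -
  have pow: "pvar i ^ k = Poly_Mapping.single (Poly_Mapping.single i k) 1" for i :: 'n and k
    by (induction k) (simp_all add: pvar_def mult_single flip: single_add)
  have "(\<Prod>i\<in>F. pvar i ^ Poly_Mapping.lookup t i) =
      Poly_Mapping.single (\<Sum>i\<in>F. Poly_Mapping.single i (Poly_Mapping.lookup t i)) 1" for F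
    by (induction F rule: infinite_finite_induct) (simp_all add: pow mult_single)
  moreover have "(\<Sum>i\<in>UNIV. Poly_Mapping.single i (Poly_Mapping.lookup t i)) = t"
    by (rule poly_mapping_eqI) (simp add: lookup_sum lookup_single when_def)
  ultimately show ?thesis by (simp add: pconst_def mult_single)
qed

lemma pring_induct [case_names const var add mult]:
  fixes p :: "('n::{finite,linorder}) pring"
  assumes const: "\<And>c. P (pconst c)" and var: "\<And>i. P (pvar i)"
    and add: "\<And>p q. P p \<Longrightarrow> P q \<Longrightarrow> P (p + q)" and mult: "\<And>p q. P p \<Longrightarrow> P q \<Longrightarrow> P (p * q)"
  shows "P p"
proof -
  have 0: "P 0" and 1: "P 1"
    using const[of 0] const[of 1] by (simp_all add: pconst_def)
  have pow: "P q \<Longrightarrow> P (q ^ k)" for q k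
    by (induction k) (auto intro: 1 mult)
  have "P (\<Prod>i\<in>F. pvar i ^ k i)" for F :: "'n set" and k
    by (induction F rule: infinite_finite_induct) (auto intro!: 1 mult pow var)
  then have single: "P (Poly_Mapping.single t c)" for t c
    by (auto simp: monomial_eq_prod_pvar intro!: mult const)
  have "P (\<Sum>t\<in>F. Poly_Mapping.single t (Poly_Mapping.lookup p t))" for F
    by (induction F rule: infinite_finite_induct) (auto intro: 0 add single)
  then show ?thesis by (metis pring_sum_monomials)
qed

lemma pconst_0 [simp]: "pconst 0 = 0"
  and pconst_1 [simp]: "pconst 1 = 1"
  and pconst_add: "pconst (a + b) = pconst a + pconst b"
  and pconst_mult: "pconst (a * b) = pconst a * pconst b"
  by (simp_all add: pconst_def single_add mult_single)

text \<open>The ring endomorphism that sends the variable \<open>x\<^sub>i\<close> to \<open>y i\<close>.\<close>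

definition psubst :: "('n \<Rightarrow> 'n pring) \<Rightarrow> ('n::{finite,linorder}) pring \<Rightarrow> 'n pring" where
  "psubst y p = (\<Sum>t\<in>Poly_Mapping.keys p.
     pconst (Poly_Mapping.lookup p t) * (\<Prod>i\<in>UNIV. y i ^ Poly_Mapping.lookup t i))"

lemma psubst_superset:
  assumes "finite F" "Poly_Mapping.keys p \<subseteq> F"
  shows "psubst y p = (\<Sum>t\<in>F. pconst (Poly_Mapping.lookup p t) * (\<Prod>i\<in>UNIV. y i ^ Poly_Mapping.lookup t i))"
  unfolding psubst_def using assms
  by (intro sum.mono_neutral_left) (auto simp: in_keys_iff)

lemma psubst_add: "psubst y (p + q) = psubst y p + psubst y q"
proof -
  let ?F = "Poly_Mapping.keys p \<union> Poly_Mapping.keys q"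
  have "Poly_Mapping.keys (p + q) \<subseteq> ?F" by (rule keys_add)
  then show ?thesis
    by (simp add: psubst_superset[where F = ?F] lookup_add pconst_add sum.distrib algebra_simps)
qed

lemma psubst_zero: "psubst y 0 = 0"
  by (simp add: psubst_def)

lemma psubst_sum: "psubst y (\<Sum>i\<in>I. g i) = (\<Sum>i\<in>I. psubst y (g i))"
  by (induction I rule: infinite_finite_induct) (simp_all add: psubst_add psubst_zero)

lemma psubst_monomial:
  "psubst y (Poly_Mapping.single t c) = pconst c * (\<Prod>i\<in>UNIV. y i ^ Poly_Mapping.lookup t i)"
  by (simp add: psubst_superset[where F = "{t}"])

lemma psubst_mult: "psubst y (p * q) = psubst y p * psubst y q"
proof -
  let ?m = "\<lambda>p t. Poly_Mapping.single t (Poly_Mapping.lookup p t)"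
  have single: "psubst y (?m p t * ?m q s) = psubst y (?m p t) * psubst y (?m q s)" for t s
    by (simp add: mult_single psubst_monomial pconst_mult lookup_add power_add prod.distrib ac_simps)
  have "p * q = (\<Sum>t\<in>Poly_Mapping.keys p. ?m p t) * (\<Sum>s\<in>Poly_Mapping.keys q. ?m q s)"
    using pring_sum_monomials[of p] pring_sum_monomials[of q] by simp
  then have "psubst y (p * q) =
      psubst y (\<Sum>t\<in>Poly_Mapping.keys p. ?m p t) * psubst y (\<Sum>s\<in>Poly_Mapping.keys q. ?m q s)"
    by (simp add: sum_product psubst_sum single)
  then show ?thesis
    by (simp flip: pring_sum_monomials)
qed

lemma psubst_pconst: "psubst y (pconst c) = pconst c"
  by (simp add: pconst_def[of c] psubst_monomial)

lemma psubst_pvar: "psubst y (pvar i) = y i"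
proof -
  have "(\<Prod>j\<in>UNIV. y j ^ Poly_Mapping.lookup (Poly_Mapping.single i 1) j) = (\<Prod>j\<in>UNIV. if j = i then y i else 1)"
    by (intro prod.cong refl) (auto simp: lookup_single)
  then show ?thesis by (simp add: pvar_def psubst_monomial)
qed

text \<open>A substitution that moves every variable by a multiple of \<open>a\<close> is the identity modulo \<open>a\<close>.\<close>

lemma dvd_diff_psubst:
  assumes "\<And>i. a dvd pvar i - y i"
  shows "a dvd p - psubst y p"
proof (induction p rule: pring_induct)
  case (add p q)
  then have "a dvd (p - psubst y p) + (q - psubst y q)" by (rule dvd_add)
  then show ?case by (simp add: psubst_add algebra_simps)
next
  case (mult p q)
  have "p * q - psubst y (p * q) = (p - psubst y p) * q + psubst y p * (q - psubst y q)"
    by (simp add: psubst_mult algebra_simps)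
  with mult show ?case by simp
qed (simp_all add: psubst_pconst psubst_pvar assms)

lemma lookup_linear_poly: "Poly_Mapping.lookup (linear_poly a) (Poly_Mapping.single i 1) = a $ i"
proof -
  have "Poly_Mapping.lookup (linear_poly a) (Poly_Mapping.single i 1) =
      (\<Sum>j\<in>UNIV. if j = i then a $ i else 0)"
    unfolding linear_poly_def lookup_sum pconst_def pvar_def mult_single
    by (intro sum.cong refl)
      (auto simp: lookup_single when_def dest!: arg_cong[where f = Poly_Mapping.keys])
  then show ?thesis by simp
qed

lemma linear_poly_eq_iff: "linear_poly a = linear_poly b \<longleftrightarrow> a = b"
  by (metis lookup_linear_poly vec_eq_iff)

lemma linear_poly_scale: "linear_poly (k *s a) = pconst k * linear_poly a"
  by (simp add: linear_poly_def pconst_mult sum_distrib_left mult.assoc)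

lemma linear_poly_zero [simp]: "linear_poly 0 = 0"
  by (simp add: linear_poly_def)

lemma linear_poly_nonzero: "a \<noteq> 0 \<Longrightarrow> linear_poly a \<noteq> 0"
  using linear_poly_eq_iff[of a 0] by simp

lemma psubst_linear_poly: "psubst y (linear_poly b) = (\<Sum>i\<in>UNIV. pconst (b $ i) * y i)"
  by (simp add: linear_poly_def psubst_sum psubst_mult psubst_pconst psubst_pvar)

text \<open>Solving \<open>a = 0\<close> for one of the variables gives an endomorphism \<open>\<theta>\<close> of the polynomial ring
  with kernel generated by \<open>a\<close>. If \<open>a\<close> divides \<open>b t\<close>, then \<open>\<theta>(b) \<theta>(t) = 0\<close>; here \<open>\<theta>(b)\<close> is a
  linear form, and it is non-zero unless \<open>b\<close> is a multiple of \<open>a\<close>.\<close>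

lemma linear_poly_dvd_cancel:
  fixes a b :: "('n::{finite,linorder}) cvec"
  assumes a: "a \<noteq> 0" and b: "\<And>k. b \<noteq> k *s a" and dvd: "linear_poly a dvd linear_poly b * t"
  shows "linear_poly a dvd t"
proof -
  from a obtain i0 where i0: "a $ i0 \<noteq> 0" by (auto simp: vec_eq_iff)
  define y where "y i = pvar i - (if i = i0 then pconst (1 / a $ i0) * linear_poly a else 0)" for i
  have sub: "psubst y (linear_poly c) = linear_poly c - pconst (c $ i0 / a $ i0) * linear_poly a" for c
  proof -
    have "psubst y (linear_poly c) = (\<Sum>i\<in>UNIV. pconst (c $ i) * pvar i -
        (if i = i0 then pconst (c $ i0) * (pconst (1 / a $ i0) * linear_poly a) else 0))"
      unfolding psubst_linear_poly by (intro sum.cong) (auto simp: y_def algebra_simps)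
    also have "\<dots> = linear_poly c -
        (\<Sum>i\<in>UNIV. if i = i0 then pconst (c $ i0) * (pconst (1 / a $ i0) * linear_poly a) else 0)"
      by (simp add: sum_subtractf linear_poly_def[of c])
    also have "\<dots> = linear_poly c - pconst (c $ i0 / a $ i0) * linear_poly a"
      by (simp add: mult.assoc[symmetric] flip: pconst_mult)
    finally show ?thesis .
  qed
  have a0: "psubst y (linear_poly a) = 0"
    using i0 by (simp add: sub)
  have b0: "psubst y (linear_poly b) \<noteq> 0"
    using b[of "b $ i0 / a $ i0"] by (simp add: sub linear_poly_eq_iff flip: linear_poly_scale)
  from dvd obtain u where "linear_poly b * t = linear_poly a * u" by (auto simp: dvd_def)
  then have "psubst y (linear_poly b) * psubst y t = 0"
    by (metis psubst_mult a0 mult_zero_left)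
  with b0 have "psubst y t = 0" by simp
  with dvd_diff_psubst[of "linear_poly a" y t] show ?thesis by (simp add: y_def)
qed

lemma linear_poly_dvd_cancel_prod:
  fixes a :: "('n::{finite,linorder}) cvec"
  assumes "a \<noteq> 0" "\<And>H k. H \<in> F \<Longrightarrow> \<alpha> H \<noteq> k *s a"
    and "linear_poly a dvd (\<Prod>H\<in>F. linear_poly (\<alpha> H)) * t"
  shows "linear_poly a dvd t"
  using assms(2,3)
proof (induction F rule: infinite_finite_induct)
  case (insert H F)
  then have "linear_poly a dvd linear_poly (\<alpha> H) * ((\<Prod>H\<in>F. linear_poly (\<alpha> H)) * t)"
    by (simp add: mult.assoc)
  then have "linear_poly a dvd (\<Prod>H\<in>F. linear_poly (\<alpha> H)) * t"
    by (rule linear_poly_dvd_cancel[OF assms(1), rotated]) (rule insert.prems(1), simp)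
  then show ?case
    by (intro insert.IH insert.prems(1)) simp_all
qed simp_all

text \<open>Pairwise coprime factors may be divided off one at a time: after division by the others, the
  next one still divides the quotient.\<close>

lemma prod_linear_poly_dvd:
  fixes \<alpha> :: "'h \<Rightarrow> ('n::{finite,linorder}) cvec"
  assumes "finite F" "\<And>H. H \<in> F \<Longrightarrow> \<alpha> H \<noteq> 0"
    and "\<And>H H' k. H \<in> F \<Longrightarrow> H' \<in> F \<Longrightarrow> H \<noteq> H' \<Longrightarrow> \<alpha> H \<noteq> k *s \<alpha> H'"
    and "\<And>H. H \<in> F \<Longrightarrow> linear_poly (\<alpha> H) dvd t"
  shows "(\<Prod>H\<in>F. linear_poly (\<alpha> H)) dvd t"
  using assms
proof (induction F rule: finite_induct)
  case (insert H F)
  have "(\<Prod>H\<in>F. linear_poly (\<alpha> H)) dvd t"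
    by (intro insert.IH insert.prems) simp_all
  then obtain u where u: "t = (\<Prod>H\<in>F. linear_poly (\<alpha> H)) * u" by (auto simp: dvd_def)
  have "linear_poly (\<alpha> H) dvd (\<Prod>H\<in>F. linear_poly (\<alpha> H)) * u"
    using insert.prems(3)[of H] u by simp
  then have "linear_poly (\<alpha> H) dvd u"
  proof (rule linear_poly_dvd_cancel_prod[rotated 2])
    show "\<alpha> H \<noteq> 0" by (rule insert.prems(1)) simp
    show "\<alpha> H' \<noteq> k *s \<alpha> H" if "H' \<in> F" for H' k
      using insert.hyps that by (intro insert.prems(2)) auto
  qed
  then have "linear_poly (\<alpha> H) * (\<Prod>H\<in>F. linear_poly (\<alpha> H)) dvd u * (\<Prod>H\<in>F. linear_poly (\<alpha> H))"
    by (rule mult_dvd_mono) simp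
  then show ?case using insert.hyps by (simp add: u mult.commute)
qed simp

section \<open>Homogeneous components\<close>

definition hcomp :: "int \<Rightarrow> ('n::{finite,linorder}) pring \<Rightarrow> 'n pring" where
  "hcomp d p = Poly_Mapping.mapp
     (\<lambda>t c. if int (\<Sum>i\<in>UNIV. Poly_Mapping.lookup t i) = d then c else 0) p"

lemma lookup_hcomp: "Poly_Mapping.lookup (hcomp d p) t =
    (if int (\<Sum>i\<in>UNIV. Poly_Mapping.lookup t i) = d then Poly_Mapping.lookup p t else 0)"
  by (simp add: hcomp_def lookup_mapp when_def in_keys_iff)

lemma hcomp_add: "hcomp d (p + q) = hcomp d p + hcomp d q"
  by (rule poly_mapping_eqI) (simp add: lookup_hcomp lookup_add)

lemma hcomp_zero [simp]: "hcomp d 0 = 0"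
  by (rule poly_mapping_eqI) (simp add: lookup_hcomp)

lemma hcomp_sum: "hcomp d (\<Sum>i\<in>I. g i) = (\<Sum>i\<in>I. hcomp d (g i))"
  by (induction I rule: infinite_finite_induct) (simp_all add: hcomp_add)

lemma hcomp_monomial: "hcomp d (Poly_Mapping.single t c) =
    (if int (\<Sum>i\<in>UNIV. Poly_Mapping.lookup t i) = d then Poly_Mapping.single t c else 0)"
  by (rule poly_mapping_eqI) (auto simp: lookup_hcomp lookup_single when_def)

lemma poly_hom_iff_hcomp: "poly_hom d p \<longleftrightarrow> hcomp d p = p"
  unfolding poly_hom_def poly_mapping_eq_iff fun_eq_iff lookup_hcomp Ball_def in_keys_iff
  by (intro iff_allI) auto

lemma poly_hom_hcomp: "poly_hom d (hcomp d p)"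
  unfolding poly_hom_def Ball_def in_keys_iff lookup_hcomp by simp

text \<open>Multiplication by a homogeneous polynomial only shifts the components. It follows that homogeneous
  factors can be cancelled, and that components of multiples of a linear form are again multiples
  of it.\<close>

lemma hcomp_mult_hom:
  assumes "poly_hom j q"
  shows "hcomp (d + j) (p * q) = hcomp d p * q"
proof -
  let ?m = "\<lambda>p t. Poly_Mapping.single t (Poly_Mapping.lookup p t)"
  have single: "hcomp (d + j) (?m p t * ?m q s) = hcomp d (?m p t) * ?m q s"
    if "s \<in> Poly_Mapping.keys q" for t s
    using assms that by (auto simp: mult_single hcomp_monomial lookup_add sum.distrib poly_hom_def)
  have "p * q = (\<Sum>t\<in>Poly_Mapping.keys p. ?m p t) * (\<Sum>s\<in>Poly_Mapping.keys q. ?m q s)"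
    using pring_sum_monomials[of p] pring_sum_monomials[of q] by simp
  then have "hcomp (d + j) (p * q) =
      hcomp d (\<Sum>t\<in>Poly_Mapping.keys p. ?m p t) * (\<Sum>s\<in>Poly_Mapping.keys q. ?m q s)"
    by (simp add: sum_product hcomp_sum single)
  then show ?thesis
    by (simp flip: pring_sum_monomials)
qed

lemma poly_hom_mult: "poly_hom d p \<Longrightarrow> poly_hom e q \<Longrightarrow> poly_hom (d + e) (p * q)"
  using hcomp_mult_hom[of e q d p] by (simp add: poly_hom_iff_hcomp)

lemma poly_hom_add: "poly_hom d p \<Longrightarrow> poly_hom d q \<Longrightarrow> poly_hom d (p + q)"
  by (simp add: poly_hom_iff_hcomp hcomp_add)

lemma poly_hom_zero [simp]: "poly_hom d 0"
  by (simp add: poly_hom_def)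

lemma poly_hom_cancel:
  assumes "poly_hom (d + j) (p * q)" "poly_hom j q" "q \<noteq> 0"
  shows "poly_hom d p"
  using assms hcomp_mult_hom[of j q d p] by (simp add: poly_hom_iff_hcomp)

lemma poly_hom_pconst [simp]: "poly_hom 0 (pconst c)"
  by (simp add: poly_hom_def pconst_def)

lemma poly_hom_one [simp]: "poly_hom 0 1"
  using poly_hom_pconst[of 1] by simp

lemma poly_hom_pvar [simp]: "poly_hom 1 (pvar i)"
  by (simp add: poly_hom_def pvar_def lookup_single when_def)

lemma poly_hom_sum: "(\<And>i. i \<in> I \<Longrightarrow> poly_hom d (g i)) \<Longrightarrow> poly_hom d (\<Sum>i\<in>I. g i)"
  by (induction I rule: infinite_finite_induct) (simp_all add: poly_hom_add)

lemma poly_hom_linear_poly: "poly_hom 1 (linear_poly a)"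
  unfolding linear_poly_def
  using poly_hom_mult[OF poly_hom_pconst poly_hom_pvar] by (intro poly_hom_sum) simp

lemma poly_hom_prod_linear_poly: "finite F \<Longrightarrow> poly_hom (int (card F)) (\<Prod>H\<in>F. linear_poly (\<alpha> H))"
proof (induction F rule: finite_induct)
  case (insert H F)
  then show ?case
    using poly_hom_mult[OF poly_hom_linear_poly insert.IH, of "\<alpha> H"] by simp
qed simp

lemma sum_hcomp:
  assumes "finite D" "(\<lambda>t. int (\<Sum>i\<in>UNIV. Poly_Mapping.lookup t i)) ` Poly_Mapping.keys p \<subseteq> D"
  shows "(\<Sum>d\<in>D. hcomp d p) = p"
proof (rule poly_mapping_eqI)
  fix t
  show "Poly_Mapping.lookup (\<Sum>d\<in>D. hcomp d p) t = Poly_Mapping.lookup p t"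
    using assms by (cases "t \<in> Poly_Mapping.keys p") (auto simp: lookup_sum lookup_hcomp in_keys_iff)
qed

lemma ratfun_hom_to_fract_quotient:
  "poly_hom i a \<Longrightarrow> poly_hom j b \<Longrightarrow> b \<noteq> 0 \<Longrightarrow> ratfun_hom (i - j) (to_fract a / to_fract b)"
  unfolding ratfun_hom_def by blast

lemma ratfun_hom_to_fract: "poly_hom d p \<Longrightarrow> ratfun_hom d (to_fract p)"
  using ratfun_hom_to_fract_quotient[of d p 0 1] by simp

lemma ratfun_hom_zero [simp]: "ratfun_hom d 0"
  using ratfun_hom_to_fract[of d 0] by simp

lemma ratfun_hom_one [simp]: "ratfun_hom 0 1"
  using ratfun_hom_to_fract[of 0 1] by simp

lemma ratfun_hom_add:
  assumes "ratfun_hom d r" "ratfun_hom d s"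
  shows "ratfun_hom d (r + s)"
proof -
  from assms obtain a b i j a' b' i' j' where
    *: "b \<noteq> 0" "poly_hom i a" "poly_hom j b" "d = i - j" "r = to_fract a / to_fract b"
      "b' \<noteq> 0" "poly_hom i' a'" "poly_hom j' b'" "d = i' - j'" "s = to_fract a' / to_fract b'"
    unfolding ratfun_hom_def by blast
  have "r + s = to_fract (a * b' + a' * b) / to_fract (b * b')"
    using * by (simp add: field_simps)
  moreover have "poly_hom (i + j') (a * b' + a' * b)"
    using poly_hom_mult[OF *(2,8)] poly_hom_mult[OF *(7,3)] *(4,9)
    by (intro poly_hom_add) (simp_all add: algebra_simps)
  moreover have "poly_hom (j + j') (b * b')" using * by (intro poly_hom_mult)
  moreover have "b * b' \<noteq> 0" "d = (i + j') - (j + j')" using * by simp_all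
  ultimately show ?thesis using ratfun_hom_to_fract_quotient by metis
qed

lemma ratfun_hom_mult:
  assumes "ratfun_hom d r" "ratfun_hom e s"
  shows "ratfun_hom (d + e) (r * s)"
proof -
  from assms obtain a b i j a' b' i' j' where
    *: "b \<noteq> 0" "poly_hom i a" "poly_hom j b" "d = i - j" "r = to_fract a / to_fract b"
      "b' \<noteq> 0" "poly_hom i' a'" "poly_hom j' b'" "e = i' - j'" "s = to_fract a' / to_fract b'"
    unfolding ratfun_hom_def by blast
  have "r * s = to_fract (a * a') / to_fract (b * b')" using * by simp
  moreover have "poly_hom (i + i') (a * a')" "poly_hom (j + j') (b * b')"
    using * by (auto intro: poly_hom_mult)
  moreover have "b * b' \<noteq> 0" "d + e = (i + i') - (j + j')" using * by simp_all
  ultimately show ?thesis using ratfun_hom_to_fract_quotient by metis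
qed

lemma ratfun_hom_inverse:
  assumes "ratfun_hom d r"
  shows "ratfun_hom (- d) (inverse r)"
proof (cases "r = 0")
  case False
  from assms obtain a b i j where
    *: "b \<noteq> 0" "poly_hom i a" "poly_hom j b" "d = i - j" "r = to_fract a / to_fract b"
    unfolding ratfun_hom_def by blast
  with False have "a \<noteq> 0" by auto
  with * have "ratfun_hom (j - i) (to_fract b / to_fract a)"
    by (intro ratfun_hom_to_fract_quotient)
  with * show ?thesis by simp
qed simp

lemma ratfun_hom_cancel:
  assumes "ratfun_hom (d + e) (r * s)" "ratfun_hom e s" "s \<noteq> 0"
  shows "ratfun_hom d r"
  using ratfun_hom_mult[OF assms(1) ratfun_hom_inverse[OF assms(2)]] assms(3)
  by (simp add: mult.assoc)

text \<open>The homogeneous fraction that witnesses the left side may be a different representation of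
  \<open>p\<close>; cancelling its denominator shows that \<open>p\<close> itself is homogeneous.\<close>

lemma ratfun_hom_to_fract_iff: "ratfun_hom d (to_fract p) \<longleftrightarrow> poly_hom d p"
proof
  assume "ratfun_hom d (to_fract p)"
  then obtain a b i j where
    *: "b \<noteq> 0" "poly_hom i a" "poly_hom j b" "d = i - j" "to_fract p = to_fract a / to_fract b"
    unfolding ratfun_hom_def by blast
  then have "to_fract (p * b) = to_fract a" by (simp add: field_simps)
  then have "p * b = a" by (simp del: to_fract_mult)
  with * have "poly_hom (d + j) (p * b)" by simp
  then show "poly_hom d p" using * by (metis poly_hom_cancel)
qed (rule ratfun_hom_to_fract)

lemma ratfun_hom_sum: "(\<And>i. i \<in> I \<Longrightarrow> ratfun_hom d (g i)) \<Longrightarrow> ratfun_hom d (\<Sum>i\<in>I. g i)"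
  by (induction I rule: infinite_finite_induct) (simp_all add: ratfun_hom_add)

lemma ratfun_hom_sign: "ratfun_hom 0 ((- 1) ^ k)"
proof (induction k)
  case (Suc k)
  have "ratfun_hom 0 (- 1 :: 'a ratfun)"
    using ratfun_hom_to_fract[OF poly_hom_pconst, of "- 1"] by (simp only: pconst_def single_uminus single_one to_fract_uminus to_fract_1)
  from ratfun_hom_mult[OF this Suc] show ?case by simp
qed simp

section \<open>Regular forms and logarithmic forms\<close>

definition is_poly :: "('n::{finite,linorder}) ratfun \<Rightarrow> bool" where
  "is_poly r \<longleftrightarrow> r \<in> range to_fract"

lemma is_poly_to_fract [simp]: "is_poly (to_fract p)"
  by (simp add: is_poly_def)

lemma is_polyE: "is_poly r \<Longrightarrow> (\<And>p. r = to_fract p \<Longrightarrow> thesis) \<Longrightarrow> thesis"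
  by (auto simp: is_poly_def)

lemma is_poly_0 [simp]: "is_poly 0" and is_poly_1 [simp]: "is_poly 1"
  using is_poly_to_fract[of 0] is_poly_to_fract[of 1] by simp_all

lemma is_poly_add: "is_poly r \<Longrightarrow> is_poly s \<Longrightarrow> is_poly (r + s)"
  by (elim is_polyE) (simp flip: to_fract_add)

lemma is_poly_mult: "is_poly r \<Longrightarrow> is_poly s \<Longrightarrow> is_poly (r * s)"
  by (elim is_polyE) (simp flip: to_fract_mult)

lemma is_poly_uminus: "is_poly r \<Longrightarrow> is_poly (- r)"
  by (elim is_polyE) (simp flip: to_fract_uminus)

lemma is_poly_sum: "(\<And>i. i \<in> I \<Longrightarrow> is_poly (g i)) \<Longrightarrow> is_poly (\<Sum>i\<in>I. g i)"
  by (induction I rule: infinite_finite_induct) (simp_all add: is_poly_add)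

lemma is_poly_sign [simp]: "is_poly ((- 1) ^ k)"
  by (induction k) (simp_all add: is_poly_uminus)

lemma is_poly_shuffle_sign [simp]: "is_poly (shuffle_sign S T)"
  by (simp add: shuffle_sign_def)

lemma is_poly_divide_iff:
  assumes "a \<noteq> 0"
  shows "is_poly (to_fract s / to_fract a) \<longleftrightarrow> a dvd s"
proof
  assume "is_poly (to_fract s / to_fract a)"
  then obtain t where "to_fract s / to_fract a = to_fract t" by (rule is_polyE)
  with assms have "to_fract s = to_fract (a * t)" by (simp add: field_simps)
  then show "a dvd s" by (simp del: to_fract_mult)
next
  assume "a dvd s"
  with assms show "is_poly (to_fract s / to_fract a)" by (auto simp: dvd_def)
qed

definition regular :: "('n::{finite,linorder}) form \<Rightarrow> bool" where
  "regular \<omega> \<longleftrightarrow> (\<forall>S. is_poly (\<omega> $ S))"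

lemma regular_0 [simp]: "regular 0"
  by (simp add: regular_def)

lemma regular_dx [simp]: "regular (dx S)"
  by (simp add: regular_def dx_component)

lemma regular_add: "regular a \<Longrightarrow> regular b \<Longrightarrow> regular (a + b)"
  by (simp add: regular_def is_poly_add)

lemma regular_minus: "regular a \<Longrightarrow> regular (- a)"
  by (simp add: regular_def is_poly_uminus)

lemma regular_diff: "regular a \<Longrightarrow> regular b \<Longrightarrow> regular (a - b)"
  using regular_add[of a "- b"] by (simp add: regular_minus)

lemma regular_scale: "is_poly r \<Longrightarrow> regular a \<Longrightarrow> regular (r *s a)"
  by (simp add: regular_def is_poly_mult)

lemma regular_sum: "(\<And>i. i \<in> I \<Longrightarrow> regular (g i)) \<Longrightarrow> regular (\<Sum>i\<in>I. g i)"
  by (induction I rule: infinite_finite_induct) (simp_all add: regular_add)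

lemma regular_wedge: "regular a \<Longrightarrow> regular b \<Longrightarrow> regular (a \<and>\<^sub>w b)"
  unfolding regular_def wedge_component
  by (intro allI is_poly_sum is_poly_mult) simp_all

lemma regular_contract: "(\<And>i. is_poly (w i)) \<Longrightarrow> regular a \<Longrightarrow> regular (contract w a)"
  unfolding regular_def contract_component
  by (intro allI is_poly_sum is_poly_mult) simp_all

lemma regular_grade_involution: "regular a \<Longrightarrow> regular (grade_involution a)"
  by (simp add: regular_def grade_involution_def is_poly_mult)

lemma of_degree_0 [simp]: "of_degree p 0"
  by (simp add: of_degree_def)

lemma of_degree_dx [simp]: "of_degree (card S) (dx S)"
  by (auto simp: of_degree_def dx_component)

lemma of_degree_add: "of_degree p a \<Longrightarrow> of_degree p b \<Longrightarrow> of_degree p (a + b)"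
  by (simp add: of_degree_def)

lemma of_degree_scale: "of_degree p a \<Longrightarrow> of_degree p (r *s a)"
  by (simp add: of_degree_def)

lemma of_degree_sum: "(\<And>i. i \<in> I \<Longrightarrow> of_degree p (g i)) \<Longrightarrow> of_degree p (\<Sum>i\<in>I. g i)"
  by (induction I rule: infinite_finite_induct) (simp_all add: of_degree_add)

text \<open>The grading involution supplies the sign, so that no degree of \<open>b\<close> has to be fixed.\<close>

lemma wedge_degree_one_commute:
  assumes "of_degree 1 a"
  shows "a \<and>\<^sub>w b = grade_involution b \<and>\<^sub>w a"
proof (induction b rule: form_linear_induct)
  case (dx T)
  show ?case
    using wedge_graded_commute[OF assms of_degree_dx[of T]]
    by (simp add: grade_involution_dx wedge_scale_left)
qed (simp_all add: wedge_add_left wedge_add_right wedge_scale_left wedge_scale_right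
    grade_involution_add grade_involution_scale)

lemma d_linear_expansion: "d_linear c = (\<Sum>i\<in>UNIV. to_fract (pconst (c $ i)) *s dx {i})"
proof -
  have "d_linear c $ S = (\<Sum>i\<in>UNIV. to_fract (pconst (c $ i)) *s dx {i}) $ S" for S
    unfolding d_linear_def sum_component by (simp add: dx_component) (auto intro: sum.cong)
  then show ?thesis by (simp add: vec_eq_iff)
qed

lemma regular_d_linear [simp]: "regular (d_linear c)"
  unfolding d_linear_expansion by (intro regular_sum regular_scale) simp_all

lemma of_degree_d_linear [simp]: "of_degree 1 (d_linear c)"
  unfolding d_linear_expansion
  using of_degree_dx[of "{i}" for i] by (intro of_degree_sum of_degree_scale) simp

lemma of_degree_dlog [simp]: "of_degree 1 (dlog c)"
  unfolding dlog_def by (intro of_degree_scale of_degree_d_linear)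

lemma contract_d_linear: "contract w (d_linear c) = (\<Sum>i\<in>UNIV. to_fract (pconst (c $ i)) * w i) *s dx {}"
  by (simp add: d_linear_expansion contract_sum contract_scale contract_dx vec.scale_sum_left)

lemma contract_d_linear_wedge:
  "contract w (d_linear c \<and>\<^sub>w \<omega>) =
    (\<Sum>i\<in>UNIV. to_fract (pconst (c $ i)) * w i) *s \<omega> - d_linear c \<and>\<^sub>w contract w \<omega>"
  using grade_involution_of_degree[OF of_degree_d_linear, of c]
  by (simp add: contract_wedge contract_d_linear wedge_scale_left)

lemma contract_euler_dlog:
  assumes "c \<noteq> 0"
  shows "contract_euler (dlog c) = dx {}"
proof -
  have "(\<Sum>i\<in>UNIV. to_fract (pconst (c $ i)) * to_fract (pvar i)) = to_fract (linear_poly c)"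
    by (simp add: linear_poly_def)
  with linear_poly_nonzero[OF assms] show ?thesis
    by (simp add: dlog_def contract_euler_contract contract_scale contract_d_linear)
qed

lemma contract_euler_dlog_wedge:
  assumes "c \<noteq> 0"
  shows "contract_euler (dlog c \<and>\<^sub>w \<omega>) = \<omega> - dlog c \<and>\<^sub>w contract_euler \<omega>"
  using grade_involution_of_degree[OF of_degree_dlog, of c] contract_euler_dlog[OF assms]
  by (simp add: contract_euler_contract contract_wedge)

lemma d_linear_eq_scale_dlog: "c \<noteq> 0 \<Longrightarrow> d_linear c = to_fract (linear_poly c) *s dlog c"
  by (simp add: dlog_def linear_poly_nonzero)

locale arrangement =
  fixes A :: "('n::{finite,linorder}) cvec set set"
    and \<alpha> :: "'n cvec set \<Rightarrow> 'n cvec"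
  assumes finite_A: "finite A"
    and nonempty: "A \<noteq> {}"
    and \<alpha>_nonzero: "H \<in> A \<Longrightarrow> \<alpha> H \<noteq> 0"
    and kernel_\<alpha>: "H \<in> A \<Longrightarrow> linear_kernel (\<alpha> H) = H"
begin

definition Q :: "'n ratfun" where
  "Q = to_fract (defining_poly A \<alpha>)"

abbreviation lin :: "'n cvec set \<Rightarrow> 'n ratfun" where
  "lin H \<equiv> to_fract (linear_poly (\<alpha> H))"

lemma \<alpha>_independent:
  assumes "H \<in> A" "H' \<in> A" "H \<noteq> H'"
  shows "\<alpha> H \<noteq> k *s \<alpha> H'"
proof
  assume eq: "\<alpha> H = k *s \<alpha> H'"
  with \<alpha>_nonzero[OF assms(1)] have "k \<noteq> 0" by auto
  then have "linear_kernel (\<alpha> H) = linear_kernel (\<alpha> H')"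
    by (auto simp: eq linear_kernel_def mult.assoc simp flip: sum_distrib_left)
  with assms show False by (simp add: kernel_\<alpha>)
qed

lemma lin_nonzero: "H \<in> A \<Longrightarrow> lin H \<noteq> 0"
  by (simp add: linear_poly_nonzero \<alpha>_nonzero)

lemma Q_eq: "Q = (\<Prod>H\<in>A. lin H)"
proof -
  have "to_fract (\<Prod>H\<in>F. linear_poly (\<alpha> H)) = (\<Prod>H\<in>F. lin H)" for F
    by (induction F rule: infinite_finite_induct) simp_all
  then show ?thesis by (simp add: Q_def defining_poly_def)
qed

lemma Q_nonzero [simp]: "Q \<noteq> 0"
  by (simp add: Q_eq finite_A linear_poly_nonzero \<alpha>_nonzero)

lemma is_poly_Q [simp]: "is_poly Q"
  by (simp add: Q_def)

lemma Q_divide_lin: "H \<in> A \<Longrightarrow> Q / lin H = to_fract (\<Prod>H\<in>A - {H}. linear_poly (\<alpha> H))"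
proof -
  assume H: "H \<in> A"
  have "defining_poly A \<alpha> = linear_poly (\<alpha> H) * (\<Prod>H\<in>A - {H}. linear_poly (\<alpha> H))"
    using H finite_A by (simp add: defining_poly_def prod.remove)
  then show ?thesis using lin_nonzero[OF H] by (simp add: Q_def)
qed

lemma is_poly_Q_divide_lin: "H \<in> A \<Longrightarrow> is_poly (Q / lin H)"
  by (simp add: Q_divide_lin)

lemma is_poly_Q_divide_lin2:
  assumes "H \<in> A" "H' \<in> A" "H \<noteq> H'"
  shows "is_poly (Q / (lin H * lin H'))"
proof -
  have "defining_poly A \<alpha> = linear_poly (\<alpha> H) * (linear_poly (\<alpha> H') * (\<Prod>H\<in>A - {H} - {H'}. linear_poly (\<alpha> H)))"
    using assms finite_A
    by (simp add: defining_poly_def prod.remove[of A H] prod.remove[of "A - {H}" H'])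
  then show ?thesis using lin_nonzero assms by (simp add: Q_def)
qed

lemma Q_dlog: "H \<in> A \<Longrightarrow> Q *s dlog (\<alpha> H) = (Q / lin H) *s d_linear (\<alpha> H)"
  by (simp add: dlog_def field_simps)

lemma polar_forms_iff: "\<omega> \<in> polar_forms A \<alpha> p \<longleftrightarrow> of_degree p \<omega> \<and> regular (Q *s \<omega>)"
proof
  assume "\<omega> \<in> polar_forms A \<alpha> p"
  then obtain \<eta> where "\<eta> \<in> regular_forms p" and \<omega>: "\<omega> = inverse Q *s \<eta>"
    by (auto simp: polar_forms_def Q_def)
  moreover have "Q *s \<omega> = \<eta>" by (simp add: \<omega>)
  ultimately show "of_degree p \<omega> \<and> regular (Q *s \<omega>)"
    by (auto simp: regular_forms_def of_degree_def regular_def is_poly_def)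
next
  assume "of_degree p \<omega> \<and> regular (Q *s \<omega>)"
  then have "Q *s \<omega> \<in> regular_forms p" and "\<omega> = inverse Q *s (Q *s \<omega>)"
    using Q_nonzero by (auto simp: regular_forms_def of_degree_def regular_def is_poly_def)
  then show "\<omega> \<in> polar_forms A \<alpha> p"
    unfolding polar_forms_def Q_def[symmetric] by blast
qed

lemma log_forms_iff:
  "\<omega> \<in> log_forms A \<alpha> p \<longleftrightarrow>
    of_degree p \<omega> \<and> regular (Q *s \<omega>) \<and> (\<forall>H\<in>A. regular (Q *s (dlog (\<alpha> H) \<and>\<^sub>w \<omega>)))"
  using of_degree_wedge[OF of_degree_dlog, of p \<omega>] by (auto simp: log_forms_def polar_forms_iff)

text \<open>Since the linear forms are pairwise coprime primes, poles along the arrangement may be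
  controlled one hyperplane at a time.\<close>

lemma regular_from_hyperplanes:
  assumes "regular ((Q * Q) *s \<omega>)" and H: "\<And>H. H \<in> A \<Longrightarrow> regular ((Q * Q / lin H) *s \<omega>)"
  shows "regular (Q *s \<omega>)"
  unfolding regular_def
proof
  fix S
  from assms(1) have "is_poly (Q * Q * \<omega> $ S)" by (simp add: regular_def)
  then obtain s where s: "Q * Q * \<omega> $ S = to_fract s" by (rule is_polyE)
  have "linear_poly (\<alpha> H) dvd s" if "H \<in> A" for H
  proof -
    have "is_poly (to_fract s / lin H)"
      using H[OF that] by (simp add: regular_def flip: s)
    then show ?thesis by (simp add: is_poly_divide_iff linear_poly_nonzero \<alpha>_nonzero that)
  qed
  then have "defining_poly A \<alpha> dvd s"
    unfolding defining_poly_def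
    by (intro prod_linear_poly_dvd finite_A \<alpha>_nonzero \<alpha>_independent)
  then have "is_poly (to_fract s / Q)"
    using Q_nonzero unfolding Q_def by (subst is_poly_divide_iff) auto
  also have "to_fract s / Q = (Q *s \<omega>) $ S" by (simp flip: s)
  finally show "is_poly ((Q *s \<omega>) $ S)" .
qed

text \<open>For a constant vector field \<open>v\<close> with \<open>\<alpha>\<^sub>H(v) = 1\<close> the splitting is the Leibniz rule for the
  contraction of \<open>d\<alpha>\<^sub>H \<and> \<omega>\<close>. If \<open>\<omega>\<close> is logarithmic, the first summand has no pole along \<open>H\<close>.\<close>

lemma log_form_split:
  assumes H: "H \<in> A"
  obtains v :: "'n \<Rightarrow> 'n ratfun" where "\<And>i. is_poly (v i)"
    "\<And>\<omega>. \<omega> = contract v (d_linear (\<alpha> H) \<and>\<^sub>w \<omega>) + d_linear (\<alpha> H) \<and>\<^sub>w contract v \<omega>"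
proof -
  from \<alpha>_nonzero[OF H] obtain i0 where i0: "\<alpha> H $ i0 \<noteq> 0" by (auto simp: vec_eq_iff)
  define v :: "'n \<Rightarrow> 'n ratfun" where "v i = (if i = i0 then to_fract (pconst (1 / \<alpha> H $ i0)) else 0)" for i
  have "(\<Sum>i\<in>UNIV. to_fract (pconst (\<alpha> H $ i)) * v i) = to_fract (pconst (\<alpha> H $ i0) * pconst (1 / \<alpha> H $ i0))"
    by (simp add: v_def if_distrib cong: if_cong)
  also have "\<dots> = 1" using i0 by (simp flip: pconst_mult)
  finally have "\<omega> = contract v (d_linear (\<alpha> H) \<and>\<^sub>w \<omega>) + d_linear (\<alpha> H) \<and>\<^sub>w contract v \<omega>"
    for \<omega> :: "'n form"
    by (simp add: contract_d_linear_wedge)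
  moreover have "is_poly (v i)" for i by (simp add: v_def)
  ultimately show ?thesis using that by blast
qed

text \<open>Write \<open>\<omega> = \<omega>' + d\<alpha>\<^sub>H \<and> \<omega>''\<close> as in \<open>log_form_split\<close>, where \<open>\<omega>'\<close> has no pole along \<open>H\<close>. Then
  \<open>\<omega>' \<and> \<eta>\<close> has at most the simple pole of \<open>\<eta>\<close>, and in \<open>d\<alpha>\<^sub>H \<and> \<omega>'' \<and> \<eta>\<close>, up to sign
  \<open>\<omega>'' \<and> (d\<alpha>\<^sub>H \<and> \<eta>)\<close>, the second factor has no pole along \<open>H\<close>. Similarly \<open>d\<alpha>\<^sub>H \<and> \<omega> \<and> \<eta>\<close>
  equals \<open>d\<alpha>\<^sub>H \<and> \<omega>' \<and> \<eta>\<close>, which has no pole along \<open>H\<close> at all. The poles along the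
  other hyperplanes are kept under control by the crude factor \<open>f\<^sup>2\<close>.\<close>

lemma log_forms_wedge:
  assumes "\<omega> \<in> log_forms A \<alpha> p" "\<eta> \<in> log_forms A \<alpha> q"
  shows "\<omega> \<and>\<^sub>w \<eta> \<in> log_forms A \<alpha> (p + q)"
proof -
  have deg: "of_degree p \<omega>" "of_degree q \<eta>"
    and reg: "regular (Q *s \<omega>)" "regular (Q *s \<eta>)"
    and log: "\<And>H. H \<in> A \<Longrightarrow> regular (Q *s (dlog (\<alpha> H) \<and>\<^sub>w \<omega>))"
      "\<And>H. H \<in> A \<Longrightarrow> regular (Q *s (dlog (\<alpha> H) \<and>\<^sub>w \<eta>))"
    using assms by (auto simp: log_forms_iff)
  have "regular ((Q *s \<omega>) \<and>\<^sub>w (Q *s \<eta>))" by (intro regular_wedge reg)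
  then have QQ: "regular ((Q * Q) *s (\<omega> \<and>\<^sub>w \<eta>))"
    by (simp add: wedge_scale_left wedge_scale_right)
  have QQ_lin: "regular ((Q * Q / lin H) *s (\<omega> \<and>\<^sub>w \<eta>))"
    and QQ_lin2: "regular ((Q * Q / (lin H * lin H)) *s (d_linear (\<alpha> H) \<and>\<^sub>w \<omega> \<and>\<^sub>w \<eta>))"
    if H: "H \<in> A" for H
  proof -
    let ?d = "d_linear (\<alpha> H)" and ?dl = "dlog (\<alpha> H)"
    obtain v where v: "\<And>i. is_poly (v i)"
        "\<And>\<omega>. \<omega> = contract v (?d \<and>\<^sub>w \<omega>) + ?d \<and>\<^sub>w contract v \<omega>"
      using log_form_split[OF H] by blast
    have d: "?d = lin H *s ?dl" by (rule d_linear_eq_scale_dlog) (rule \<alpha>_nonzero[OF H])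
    have "(Q * Q / lin H) *s (contract v (?d \<and>\<^sub>w \<omega>) \<and>\<^sub>w \<eta>) =
        contract v (Q *s (?dl \<and>\<^sub>w \<omega>)) \<and>\<^sub>w (Q *s \<eta>)"
      using lin_nonzero[OF H]
      by (simp add: d wedge_scale_left wedge_scale_right contract_scale)
    moreover have "regular \<dots>"
      by (intro regular_wedge regular_contract v log reg H)
    moreover have "(Q * Q / lin H) *s (?d \<and>\<^sub>w contract v \<omega> \<and>\<^sub>w \<eta>) =
        grade_involution (contract v (Q *s \<omega>)) \<and>\<^sub>w (Q *s (?dl \<and>\<^sub>w \<eta>))"
    proof -
      have "?dl \<and>\<^sub>w contract v \<omega> \<and>\<^sub>w \<eta> = grade_involution (contract v \<omega>) \<and>\<^sub>w ?dl \<and>\<^sub>w \<eta>"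
        by (metis wedge_assoc wedge_degree_one_commute of_degree_dlog)
      then show ?thesis
        using lin_nonzero[OF H]
        by (simp add: d wedge_scale_left wedge_scale_right contract_scale grade_involution_scale)
    qed
    moreover have "regular \<dots>"
      by (intro regular_wedge regular_contract regular_grade_involution v log reg H)
    moreover have "\<omega> \<and>\<^sub>w \<eta> = contract v (?d \<and>\<^sub>w \<omega>) \<and>\<^sub>w \<eta> + ?d \<and>\<^sub>w contract v \<omega> \<and>\<^sub>w \<eta>"
      by (metis v(2) wedge_add_left wedge_assoc)
    ultimately show "regular ((Q * Q / lin H) *s (\<omega> \<and>\<^sub>w \<eta>))"
      by (metis vector_add_ldistrib regular_add)
    \<comment> \<open>The other summand of \<open>\<omega>\<close> is killed by \<open>d\<alpha>\<^sub>H\<close>.\<close>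
    have "?d \<and>\<^sub>w \<omega> = ?d \<and>\<^sub>w contract v (?d \<and>\<^sub>w \<omega>)"
      using arg_cong[OF v(2)[of \<omega>], of "\<lambda>x. ?d \<and>\<^sub>w x"] of_degree_one_square_zero[OF of_degree_d_linear, of "\<alpha> H"]
      by (simp add: wedge_add_right flip: wedge_assoc)
    then have "?d \<and>\<^sub>w \<omega> \<and>\<^sub>w \<eta> = grade_involution (contract v (?d \<and>\<^sub>w \<omega>)) \<and>\<^sub>w ?d \<and>\<^sub>w \<eta>"
      by (metis wedge_assoc wedge_degree_one_commute of_degree_d_linear)
    then have "(Q * Q / (lin H * lin H)) *s (?d \<and>\<^sub>w \<omega> \<and>\<^sub>w \<eta>) =
        grade_involution (contract v (Q *s (?dl \<and>\<^sub>w \<omega>))) \<and>\<^sub>w (Q *s (?dl \<and>\<^sub>w \<eta>))"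
      using lin_nonzero[OF H]
      by (simp add: d wedge_scale_left wedge_scale_right contract_scale grade_involution_scale)
    moreover have "regular \<dots>"
      by (intro regular_wedge regular_contract regular_grade_involution v log H)
    ultimately show "regular ((Q * Q / (lin H * lin H)) *s (?d \<and>\<^sub>w \<omega> \<and>\<^sub>w \<eta>))"
      by simp
  qed
  have Q\<omega>\<eta>: "regular (Q *s (\<omega> \<and>\<^sub>w \<eta>))"
    by (rule regular_from_hyperplanes[OF QQ QQ_lin])
  have "regular (Q *s (dlog (\<alpha> H) \<and>\<^sub>w \<omega> \<and>\<^sub>w \<eta>))" if H: "H \<in> A" for H
    unfolding regular_def
  proof
    fix S
    let ?r = "(d_linear (\<alpha> H) \<and>\<^sub>w \<omega> \<and>\<^sub>w \<eta>) $ S"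
    have "regular (d_linear (\<alpha> H) \<and>\<^sub>w (Q *s (\<omega> \<and>\<^sub>w \<eta>)))"
      by (intro regular_wedge Q\<omega>\<eta>) simp
    then have "is_poly (Q * ?r)" by (simp add: regular_def wedge_scale_right)
    then obtain s where s: "Q * ?r = to_fract s" by (rule is_polyE)
    have "is_poly (Q * Q / (lin H * lin H) * ?r)" using QQ_lin2[OF H] by (simp add: regular_def)
    also have "Q * Q / (lin H * lin H) * ?r = Q / lin H * to_fract s / lin H"
      by (simp flip: s)
    \<comment> \<open>Only \<open>\<alpha>\<^sub>H\<close> itself is at stake here: \<open>f/\<alpha>\<^sub>H\<close> is prime to it and can be cancelled.\<close>
    finally have "is_poly (to_fract ((\<Prod>H\<in>A - {H}. linear_poly (\<alpha> H)) * s) / lin H)"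
      by (simp add: Q_divide_lin[OF H])
    then have "linear_poly (\<alpha> H) dvd (\<Prod>H\<in>A - {H}. linear_poly (\<alpha> H)) * s"
      using H by (subst (asm) is_poly_divide_iff) (simp_all add: linear_poly_nonzero \<alpha>_nonzero)
    then have "linear_poly (\<alpha> H) dvd s"
      using H by (intro linear_poly_dvd_cancel_prod[of "\<alpha> H" "A - {H}" \<alpha> s]) (auto simp: \<alpha>_nonzero \<alpha>_independent)
    then have "is_poly (to_fract s / lin H)"
      using H by (simp add: is_poly_divide_iff linear_poly_nonzero \<alpha>_nonzero)
    then show "is_poly ((Q *s (dlog (\<alpha> H) \<and>\<^sub>w \<omega> \<and>\<^sub>w \<eta>)) $ S)"
      by (simp add: dlog_def wedge_scale_left field_simps flip: s)
  qed
  with Q\<omega>\<eta> deg show ?thesis by (simp add: log_forms_iff of_degree_wedge)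
qed

lemma log_forms_add: "\<omega> \<in> log_forms A \<alpha> p \<Longrightarrow> \<eta> \<in> log_forms A \<alpha> p \<Longrightarrow> \<omega> + \<eta> \<in> log_forms A \<alpha> p"
  by (simp add: log_forms_iff of_degree_add regular_add wedge_add_right vector_add_ldistrib)

lemma log_forms_zero: "0 \<in> log_forms A \<alpha> p"
  by (simp add: log_forms_iff)

lemma log_forms_pscale:
  assumes "\<omega> \<in> log_forms A \<alpha> p"
  shows "pscale r \<omega> \<in> log_forms A \<alpha> p"
proof -
  have "regular ((Q * to_fract r) *s a)" if "regular (Q *s a)" for a :: "'n form"
    using regular_scale[OF is_poly_to_fract that, of r] by (simp add: mult.commute)
  with assms show ?thesis
    by (simp add: log_forms_iff pscale_def of_degree_scale wedge_scale_right)
qed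

text \<open>By the Leibniz rule \<open>d\<alpha>\<^sub>H/\<alpha>\<^sub>H \<and> \<iota>(\<omega>) = \<omega> - \<iota>(d\<alpha>\<^sub>H/\<alpha>\<^sub>H \<and> \<omega>)\<close>, and both terms on the right have
  denominator \<open>f\<close>.\<close>

lemma log_forms_contract_euler:
  assumes "\<omega> \<in> log_forms A \<alpha> (Suc p)"
  shows "contract_euler \<omega> \<in> log_forms A \<alpha> p"
proof -
  have reg: "regular (contract_euler (Q *s a))" if "regular (Q *s a)" for a
    unfolding contract_euler_contract by (intro regular_contract that) simp
  have "dlog (\<alpha> H) \<and>\<^sub>w contract_euler \<omega> = \<omega> - contract_euler (dlog (\<alpha> H) \<and>\<^sub>w \<omega>)" if "H \<in> A" for H
    using contract_euler_dlog_wedge[OF \<alpha>_nonzero[OF that]] by simp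
  moreover have "regular (Q *s (\<omega> - contract_euler (dlog (\<alpha> H) \<and>\<^sub>w \<omega>)))" if "H \<in> A" for H
    using assms reg[of "dlog (\<alpha> H) \<and>\<^sub>w \<omega>"] that
    by (auto simp: log_forms_iff vec.scale_right_diff_distrib contract_euler_contract contract_scale
        intro: regular_diff)
  moreover have "regular (Q *s contract_euler \<omega>)"
    using assms reg[of \<omega>] by (simp add: log_forms_iff contract_euler_contract contract_scale)
  moreover have "of_degree p (contract_euler \<omega>)"
    using assms by (simp add: log_forms_iff contract_euler_contract of_degree_contract)
  ultimately show ?thesis by (simp add: log_forms_iff)
qed

text \<open>The contractions of the following two kinds of forms are the test forms of the duality proof:
  pairing with the first kind reads off the coefficients of \<open>\<omega>\<close>, pairing with the second kind
  those of \<open>d\<alpha>\<^sub>H/\<alpha>\<^sub>H \<and> \<omega>\<close>.\<close>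

lemma dx_log: "dx T \<in> log_forms A \<alpha> (card T)"
proof -
  have "Q *s (dlog (\<alpha> H) \<and>\<^sub>w dx T) = (Q / lin H) *s (d_linear (\<alpha> H) \<and>\<^sub>w dx T)" if "H \<in> A" for H
    using Q_dlog[OF that] by (metis wedge_scale_left)
  then show ?thesis
    by (auto simp: log_forms_iff intro!: regular_scale regular_wedge is_poly_Q_divide_lin)
qed

lemma dlog_wedge_dx_log:
  assumes "H \<in> A"
  shows "dlog (\<alpha> H) \<and>\<^sub>w dx T \<in> log_forms A \<alpha> (Suc (card T))"
proof -
  have 1: "Q *s (dlog (\<alpha> H) \<and>\<^sub>w dx T) = (Q / lin H) *s (d_linear (\<alpha> H) \<and>\<^sub>w dx T)"
    using Q_dlog[OF assms] by (metis wedge_scale_left)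
  have 2: "regular (Q *s (dlog (\<alpha> H') \<and>\<^sub>w dlog (\<alpha> H) \<and>\<^sub>w dx T))" if "H' \<in> A" for H'
  proof (cases "H' = H")
    case True
    then show ?thesis
      using of_degree_one_square_zero[OF of_degree_dlog, of "\<alpha> H"] by (simp flip: wedge_assoc)
  next
    case False
    have "Q *s (dlog (\<alpha> H') \<and>\<^sub>w dlog (\<alpha> H) \<and>\<^sub>w dx T) =
        (Q / (lin H' * lin H)) *s (d_linear (\<alpha> H') \<and>\<^sub>w d_linear (\<alpha> H) \<and>\<^sub>w dx T)"
      by (simp add: dlog_def wedge_scale_left wedge_scale_right field_simps)
    moreover have "regular \<dots>"
      using False that assms by (intro regular_scale regular_wedge is_poly_Q_divide_lin2) auto
    ultimately show ?thesis by simp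
  qed
  have "of_degree (1 + card T) (dlog (\<alpha> H) \<and>\<^sub>w dx T)"
    by (rule of_degree_wedge[OF of_degree_dlog of_degree_dx])
  with 2 show ?thesis
    unfolding log_forms_iff 1 using assms
    by (auto intro!: regular_scale regular_wedge is_poly_Q_divide_lin)
qed

end

section \<open>Homogeneous forms\<close>

lemma ratfun_hom_shuffle_sign [simp]: "ratfun_hom 0 (shuffle_sign S T)"
  by (simp add: shuffle_sign_def ratfun_hom_sign)

lemma form_hom_scale:
  assumes "ratfun_hom e r" "form_hom d \<omega>"
  shows "form_hom (e + d) (r *s \<omega>)"
  unfolding form_hom_def
proof
  fix S
  have "ratfun_hom (e + (d - int (card S))) (r * \<omega> $ S)"
    using assms by (intro ratfun_hom_mult) (simp_all add: form_hom_def)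
  then show "ratfun_hom (e + d - int (card S)) ((r *s \<omega>) $ S)" by (simp add: algebra_simps)
qed

lemma form_hom_zero [simp]: "form_hom d 0"
  by (simp add: form_hom_def)

lemma form_hom_add: "form_hom d a \<Longrightarrow> form_hom d b \<Longrightarrow> form_hom d (a + b)"
  by (simp add: form_hom_def ratfun_hom_add)

lemma form_hom_sum: "(\<And>i. i \<in> I \<Longrightarrow> form_hom d (g i)) \<Longrightarrow> form_hom d (\<Sum>i\<in>I. g i)"
  by (induction I rule: infinite_finite_induct) (simp_all add: form_hom_add)

lemma form_hom_dx: "form_hom (int (card S)) (dx S)"
  by (simp add: form_hom_def dx_component)

lemma form_hom_wedge:
  assumes "form_hom d a" "form_hom e b"
  shows "form_hom (d + e) (a \<and>\<^sub>w b)"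
  unfolding form_hom_def wedge_component
proof (intro allI ratfun_hom_sum)
  fix U S :: "'a set" assume "S \<in> Pow U"
  then have "card U = card S + card (U - S)"
    by (metis Pow_iff card_Diff_subset card_mono finite le_add_diff_inverse)
  moreover have "ratfun_hom (0 + (d - int (card S)) + (e - int (card (U - S))))
      (shuffle_sign S (U - S) * a $ S * b $ (U - S))"
    using assms by (intro ratfun_hom_mult) (simp_all add: form_hom_def)
  ultimately show "ratfun_hom (d + e - int (card U)) (shuffle_sign S (U - S) * a $ S * b $ (U - S))"
    by (simp add: algebra_simps)
qed

lemma form_hom_contract_euler:
  assumes "form_hom d a"
  shows "form_hom d (contract_euler a)"
  unfolding form_hom_def contract_euler_contract contract_component
proof (intro allI ratfun_hom_sum)
  fix T :: "'a set" and i assume "i \<in> - T"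
  then have "card (insert i T) = Suc (card T)" by simp
  moreover have "ratfun_hom (0 + 1 + (d - int (card (insert i T))))
      (shuffle_sign {i} T * to_fract (pvar i) * a $ insert i T)"
    using assms by (intro ratfun_hom_mult ratfun_hom_to_fract) (simp_all add: form_hom_def)
  ultimately show "ratfun_hom (d - int (card T)) (shuffle_sign {i} T * to_fract (pvar i) * a $ insert i T)"
    by (simp add: algebra_simps)
qed

lemma form_hom_dlog: "form_hom 0 (dlog c)"
proof -
  have "form_hom 1 (d_linear c)"
    unfolding d_linear_expansion
  proof (rule form_hom_sum)
    fix i
    have "form_hom (0 + int (card {i})) (to_fract (pconst (c $ i)) *s dx {i})"
      by (intro form_hom_scale ratfun_hom_to_fract poly_hom_pconst form_hom_dx)
    then show "form_hom 1 (to_fract (pconst (c $ i)) *s dx {i})" by simp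
  qed
  from form_hom_scale[OF ratfun_hom_inverse[OF ratfun_hom_to_fract[OF poly_hom_linear_poly]] this]
  show ?thesis by (simp add: dlog_def)
qed

lemma form_hom_omega_weight: "form_hom 0 (omega_weight A \<alpha> lam)"
  unfolding omega_weight_def pscale_def
  using form_hom_scale[OF ratfun_hom_to_fract[OF poly_hom_pconst] form_hom_dlog]
  by (intro form_hom_sum) simp

lemma of_degree_top:
  fixes \<omega> :: "('n::{finite,linorder}) form"
  assumes "of_degree CARD('n) \<omega>"
  shows "\<omega> = \<omega> $ UNIV *s dx UNIV"
proof -
  have "\<omega> $ S = 0" if "S \<noteq> UNIV" for S
    using of_degreeD[OF assms, of S] card_eq_UNIV_imp_eq_UNIV[of S, OF finite] that by blast
  then show ?thesis
    unfolding vec_eq_iff by (simp add: dx_component)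
qed

lemma of_degree_above_top:
  fixes \<omega> :: "('n::{finite,linorder}) form"
  assumes "of_degree p \<omega>" "p > CARD('n)"
  shows "\<omega> = 0"
proof -
  have "card S \<noteq> p" for S :: "'n set" using card_mono[of UNIV S] assms(2) by simp
  with assms(1) show ?thesis by (simp add: of_degree_def vec_eq_iff)
qed

definition euler_volume :: "('n::{finite,linorder}) form" where
  "euler_volume = contract_euler (dx UNIV)"

lemma euler_volume_component:
  "euler_volume $ (- {i}) = shuffle_sign {i} (- {i}) * to_fract (pvar i)"
proof -
  have "insert i (- {i}) = UNIV" by auto
  then show ?thesis
    by (simp add: euler_volume_def contract_euler_contract contract_component dx_component)
qed

lemma pvar_nonzero [simp]: "pvar i \<noteq> 0"
proof
  assume "pvar i = 0"
  then have "Poly_Mapping.lookup (pvar i) (Poly_Mapping.single i 1) = 0" by simp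
  then show False by (simp add: pvar_def)
qed

lemma form_hom_euler_volume_iff:
  fixes g :: "('n::{finite,linorder}) ratfun"
  shows "form_hom d (g *s euler_volume) \<longleftrightarrow> ratfun_hom (d - int CARD('n)) g"
proof
  assume "ratfun_hom (d - int CARD('n)) g"
  from form_hom_scale[OF this form_hom_contract_euler[OF form_hom_dx[of UNIV]]]
  show "form_hom d (g *s euler_volume)" by (simp add: euler_volume_def)
next
  assume hom: "form_hom d (g *s euler_volume)"
  fix i :: 'n
  have "card (- {i}) = CARD('n) - 1" by (simp add: Compl_eq_Diff_UNIV card_Diff_singleton)
  with hom have "ratfun_hom (d - int (CARD('n) - 1)) (g * (shuffle_sign {i} (- {i}) * to_fract (pvar i)))"
    by (metis form_hom_def euler_volume_component vector_smult_component)
  then have "ratfun_hom (d - int CARD('n) + (0 + 1)) (g * (shuffle_sign {i} (- {i}) * to_fract (pvar i)))"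
    by (simp add: of_nat_diff algebra_simps)
  then show "ratfun_hom (d - int CARD('n)) g"
    by (rule ratfun_hom_cancel) (intro ratfun_hom_mult ratfun_hom_to_fract, simp_all)
qed

lemma euler_volume_nonzero [simp]: "euler_volume \<noteq> (0 :: ('n::{finite,linorder}) form)"
proof
  fix i :: 'n
  assume "euler_volume = (0 :: 'n form)"
  then have "euler_volume $ (- {i}) = (0 :: 'n ratfun)" by simp
  then show False by (simp add: euler_volume_component)
qed

context arrangement
begin

abbreviation C :: "nat \<Rightarrow> 'n form set" where
  "C \<equiv> log_forms0 A \<alpha>"

lemma C_degree: "\<omega> \<in> C p \<Longrightarrow> of_degree p \<omega>"
  by (simp add: log_forms0_def log_forms_iff)

lemma C_contract: "\<omega> \<in> C p \<Longrightarrow> contract_euler \<omega> = 0"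
  by (simp add: log_forms0_def)

lemma C_zero: "0 \<in> C p"
  by (simp add: log_forms0_def log_forms_zero contract_euler_contract)

lemma C_add: "\<omega> \<in> C p \<Longrightarrow> \<eta> \<in> C p \<Longrightarrow> \<omega> + \<eta> \<in> C p"
  by (simp add: log_forms0_def log_forms_add contract_euler_contract contract_add)

lemma C_pscale: "\<omega> \<in> C p \<Longrightarrow> pscale r \<omega> \<in> C p"
  by (simp add: log_forms0_def log_forms_pscale) (simp add: pscale_def contract_euler_contract contract_scale)

lemma C_diff: "\<omega> \<in> C p \<Longrightarrow> \<eta> \<in> C p \<Longrightarrow> \<omega> - \<eta> \<in> C p"
  using C_add[of \<omega> p "pscale (- 1) \<eta>"] C_pscale[of \<eta> p "- 1"] by (simp add: pscale_def)

lemma C_wedge: "\<omega> \<in> C p \<Longrightarrow> \<eta> \<in> C q \<Longrightarrow> \<omega> \<and>\<^sub>w \<eta> \<in> C (p + q)"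
  by (simp add: log_forms0_def log_forms_wedge contract_euler_contract contract_wedge)

lemma C_contract_euler: "\<omega> \<in> log_forms A \<alpha> (Suc p) \<Longrightarrow> contract_euler \<omega> \<in> C p"
  by (simp add: log_forms0_def log_forms_contract_euler) (simp add: contract_euler_contract)

text \<open>Wedging with \<open>d\<alpha>\<^sub>H/\<alpha>\<^sub>H\<close> is a contracting homotopy for \<open>\<iota>\<close>.\<close>

lemma C_eq_contract_dlog: "\<omega> \<in> C p \<Longrightarrow> H \<in> A \<Longrightarrow> \<omega> = contract_euler (dlog (\<alpha> H) \<and>\<^sub>w \<omega>)"
  by (simp add: contract_euler_dlog_wedge \<alpha>_nonzero C_contract)

lemma C_above_top:
  assumes "p > CARD('n) - 1"
  shows "C p = {0}"
proof -
  have "\<omega> = 0" if "\<omega> \<in> C p" for \<omega>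
  proof -
    from nonempty obtain H where H: "H \<in> A" by blast
    have "dlog (\<alpha> H) \<and>\<^sub>w \<omega> = 0"
      using of_degree_above_top[OF of_degree_wedge[OF of_degree_dlog C_degree[OF that]]] assms by simp
    with C_eq_contract_dlog[OF that H] show ?thesis by (simp add: contract_euler_contract)
  qed
  with C_zero show ?thesis by blast
qed

lemma omega_weight_in_C:
  assumes "(\<Sum>H\<in>A. lam H) = 0"
  shows "omega_weight A \<alpha> lam \<in> C 1"
proof -
  have "dlog (\<alpha> H) \<in> log_forms A \<alpha> 1" if "H \<in> A" for H
    using dlog_wedge_dx_log[OF that, of "{}"] by simp
  then have "(\<Sum>H\<in>B. pscale (pconst (lam H)) (dlog (\<alpha> H))) \<in> log_forms A \<alpha> 1" if "B \<subseteq> A" for B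
    using that by (induction B rule: infinite_finite_induct) (auto intro: log_forms_zero log_forms_add log_forms_pscale)
  moreover have "contract_euler (omega_weight A \<alpha> lam) = 0"
  proof -
    have "contract_euler (omega_weight A \<alpha> lam) = (\<Sum>H\<in>A. to_fract (pconst (lam H)) *s dx {})"
      using contract_euler_dlog[OF \<alpha>_nonzero]
      by (simp add: omega_weight_def pscale_def contract_euler_contract contract_sum contract_scale)
    also have "\<dots> = (\<Sum>H\<in>A. to_fract (pconst (lam H))) *s dx {}"
      by (simp add: vec.scale_sum_left)
    also have "(\<Sum>H\<in>A. to_fract (pconst (lam H))) = to_fract (pconst (\<Sum>H\<in>A. lam H))"
      by (induction A rule: infinite_finite_induct) (simp_all add: pconst_add)
    finally show ?thesis by (simp add: assms)
  qed
  ultimately show ?thesis by (simp add: log_forms0_def omega_weight_def)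
qed

subsection \<open>The top degree\<close>

definition generator :: "'n form" where
  "generator = inverse Q *s euler_volume"

lemma generator_in_C: "generator \<in> C (CARD('n) - 1)"
proof -
  have "dlog (\<alpha> H) \<and>\<^sub>w dx UNIV = (0 :: 'n form)" for H
    by (rule of_degree_above_top[OF of_degree_wedge[OF of_degree_dlog of_degree_dx]]) simp
  then have "inverse Q *s dx UNIV \<in> log_forms A \<alpha> (Suc (CARD('n) - 1))"
    using of_degree_dx[of "UNIV :: 'n set"]
    by (simp add: log_forms_iff of_degree_scale wedge_scale_right)
  from C_contract_euler[OF this] show ?thesis
    by (simp add: generator_def euler_volume_def contract_euler_contract contract_scale)
qed

text \<open>The homotopy presents \<open>\<omega>\<close> as the contraction of a top form, and since \<open>\<omega>\<close> is logarithmic, the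
  coefficient of that top form has denominator \<open>f\<close>.\<close>

lemma C_top_generated:
  assumes "\<omega> \<in> C (CARD('n) - 1)"
  shows "\<exists>r. \<omega> = pscale r generator"
proof -
  from nonempty obtain H where H: "H \<in> A" by blast
  let ?\<zeta> = "dlog (\<alpha> H) \<and>\<^sub>w \<omega>"
  have "of_degree CARD('n) ?\<zeta>"
    using of_degree_wedge[OF of_degree_dlog C_degree[OF assms]] by simp
  then have \<zeta>: "?\<zeta> = ?\<zeta> $ UNIV *s dx UNIV" by (rule of_degree_top)
  have "is_poly (Q * ?\<zeta> $ UNIV)"
    using assms H by (auto simp: log_forms0_def log_forms_iff regular_def)
  then obtain r where r: "Q * ?\<zeta> $ UNIV = to_fract r" by (rule is_polyE)
  have "\<omega> = contract_euler (?\<zeta> $ UNIV *s dx UNIV)"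
    using C_eq_contract_dlog[OF assms H] \<zeta> by simp
  also have "\<dots> = pscale r generator"
    by (simp add: contract_euler_contract contract_scale pscale_def generator_def euler_volume_def
        flip: r)
  finally show ?thesis by blast
qed

lemma ratfun_hom_Q: "ratfun_hom (int (card A)) Q"
  unfolding Q_def defining_poly_def
  by (intro ratfun_hom_to_fract poly_hom_prod_linear_poly finite_A)

lemma form_hom_generator_iff:
  "form_hom d (pscale r generator) \<longleftrightarrow> poly_hom (int (card A) - int CARD('n) + d) r"
proof -
  have "form_hom d (pscale r generator) \<longleftrightarrow> ratfun_hom (d - int CARD('n)) (to_fract r * inverse Q)"
    by (simp add: pscale_def generator_def form_hom_euler_volume_iff)
  also have "\<dots> \<longleftrightarrow> ratfun_hom (int (card A) - int CARD('n) + d) (to_fract r)"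
    using ratfun_hom_mult[of "d - int CARD('n)" "to_fract r * inverse Q" "int (card A)" Q]
      ratfun_hom_mult[of "int (card A) - int CARD('n) + d" "to_fract r" "- int (card A)" "inverse Q"]
      ratfun_hom_Q ratfun_hom_inverse[OF ratfun_hom_Q]
    by (auto simp: mult.assoc algebra_simps)
  finally show ?thesis by (simp add: ratfun_hom_to_fract_iff)
qed

lemma generator_scale_eq_iff: "pscale r generator = pscale s generator \<longleftrightarrow> r = s"
  by (simp add: pscale_def generator_def)

lemma top_isomorphism_exists:
  "\<exists>\<psi>. graded_iso_shift (C (CARD('n) - 1)) (int (card A) - int CARD('n)) \<psi>"
proof -
  define \<psi> where "\<psi> \<omega> = (THE r. \<omega> = pscale r generator)" for \<omega>
  have \<psi>: "\<psi> (pscale r generator) = r" for r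
    by (simp add: \<psi>_def generator_scale_eq_iff)
  have add: "pscale r generator + pscale s generator = pscale (r + s) generator"
    and scale: "pscale r (pscale s generator) = pscale (r * s) generator" for r s
    by (simp_all add: pscale_def vec.scale_left_distrib)
  have "R_linear_on (C (CARD('n) - 1)) \<psi>"
    unfolding R_linear_on_def
  proof (intro conjI ballI allI)
    fix \<omega> \<eta> assume "\<omega> \<in> C (CARD('n) - 1)" "\<eta> \<in> C (CARD('n) - 1)"
    then obtain r s where "\<omega> = pscale r generator" "\<eta> = pscale s generator"
      using C_top_generated by blast
    then show "\<psi> (\<omega> + \<eta>) = \<psi> \<omega> + \<psi> \<eta>" by (simp add: add \<psi>)
  next
    fix r \<omega> assume "\<omega> \<in> C (CARD('n) - 1)"
    then obtain s where "\<omega> = pscale s generator"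
      using C_top_generated by blast
    then show "\<psi> (pscale r \<omega>) = r * \<psi> \<omega>" by (simp add: scale \<psi>)
  qed
  moreover have "bij_betw \<psi> (C (CARD('n) - 1)) UNIV"
  proof (rule bij_betwI[where g = "\<lambda>r. pscale r generator"])
    show "(\<lambda>r. pscale r generator) \<in> UNIV \<rightarrow> C (CARD('n) - 1)"
      using C_pscale[OF generator_in_C] by blast
    show "pscale (\<psi> \<omega>) generator = \<omega>" if "\<omega> \<in> C (CARD('n) - 1)" for \<omega>
      using C_top_generated[OF that] by (auto simp: \<psi>)
  qed (simp_all add: \<psi>)
  moreover have "form_hom d \<omega> \<longleftrightarrow> poly_hom (int (card A) - int CARD('n) + d) (\<psi> \<omega>)"
    if "\<omega> \<in> C (CARD('n) - 1)" for d \<omega>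
    using C_top_generated[OF that] by (auto simp: \<psi> form_hom_generator_iff)
  ultimately show ?thesis unfolding graded_iso_shift_def by blast
qed

subsection \<open>Homogeneous components of logarithmic forms\<close>

text \<open>Components are taken in the numerator over the common denominator \<open>f\<close>, and all coefficients of a
  form get the same index \<open>k\<close>; so the \<open>k\<close>-th component of a \<open>p\<close>-form has degree \<open>k - n + p\<close>.\<close>

definition num :: "'n ratfun \<Rightarrow> 'n pring" where
  "num r = (SOME p. Q * r = to_fract p)"

definition ncomp :: "int \<Rightarrow> 'n ratfun \<Rightarrow> 'n ratfun" where
  "ncomp k r = to_fract (hcomp k (num r)) / Q"

definition fcomp :: "int \<Rightarrow> 'n form \<Rightarrow> 'n form" where
  "fcomp k \<omega> = (\<chi> S. ncomp k (\<omega> $ S))"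

lemma num_eq: "Q * r = to_fract p \<Longrightarrow> num r = p"
  by (simp add: num_def)

lemma to_fract_num: "is_poly (Q * r) \<Longrightarrow> Q * r = to_fract (num r)"
  by (metis is_polyE num_eq)

lemma ncomp_zero [simp]: "ncomp k 0 = 0"
  using num_eq[of 0 0] by (simp add: ncomp_def)

lemma is_poly_ncomp [simp]: "is_poly (Q * ncomp k r)"
  by (simp add: ncomp_def)

lemma ncomp_add:
  assumes "is_poly (Q * r)" "is_poly (Q * s)"
  shows "ncomp k (r + s) = ncomp k r + ncomp k s"
proof -
  have "num (r + s) = num r + num s"
    using assms by (intro num_eq) (simp add: to_fract_num distrib_left)
  then show ?thesis by (simp add: ncomp_def hcomp_add add_divide_distrib)
qed

lemma ncomp_mult_hom:
  assumes "poly_hom j a" "is_poly (Q * r)"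
  shows "ncomp (k + j) (to_fract a * r) = to_fract a * ncomp k r"
proof -
  have "num (to_fract a * r) = num r * a"
    using to_fract_num[OF assms(2)] by (intro num_eq) (simp add: ac_simps)
  then show ?thesis by (simp add: ncomp_def hcomp_mult_hom[OF assms(1)])
qed

lemma ncomp_linear_combination:
  assumes "\<And>i. i \<in> I \<Longrightarrow> poly_hom j (a i)" "\<And>i. i \<in> I \<Longrightarrow> is_poly (Q * g i)"
  shows "ncomp (k + j) (\<Sum>i\<in>I. to_fract (a i) * g i) = (\<Sum>i\<in>I. to_fract (a i) * ncomp k (g i))"
  using assms
proof (induction I rule: infinite_finite_induct)
  case (insert i I)
  have poly: "is_poly (Q * (to_fract (a j) * g j))" if "j \<in> insert i I" for j
    using is_poly_mult[OF is_poly_to_fract insert.prems(2)[OF that], of "a j"] by (simp add: ac_simps)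
  have "is_poly (Q * (\<Sum>i\<in>I. to_fract (a i) * g i))"
    unfolding sum_distrib_left by (intro is_poly_sum poly) simp
  with insert poly[of i] show ?case
    by (simp add: ncomp_add ncomp_mult_hom)
qed simp_all

lemma shuffle_sign_to_fract: "\<exists>s. poly_hom 0 s \<and> shuffle_sign S T = to_fract s"
proof -
  have "is_poly (shuffle_sign S T)" by simp
  then obtain s where "shuffle_sign S T = to_fract s" by (rule is_polyE)
  with ratfun_hom_shuffle_sign[of S T] show ?thesis by (auto simp: ratfun_hom_to_fract_iff)
qed

lemma fcomp_of_degree: "of_degree p \<omega> \<Longrightarrow> of_degree p (fcomp k \<omega>)"
  by (simp add: of_degree_def fcomp_def)

lemma fcomp_contract_euler:
  assumes "regular (Q *s \<omega>)"
  shows "contract_euler (fcomp k \<omega>) = fcomp (k + 1) (contract_euler \<omega>)"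
proof -
  obtain s where s: "\<And>S T. poly_hom 0 (s S T)" "\<And>S T. shuffle_sign S T = to_fract (s S T :: 'n pring)"
    using shuffle_sign_to_fract by metis
  have "contract_euler (fcomp k \<omega>) $ T = fcomp (k + 1) (contract_euler \<omega>) $ T" for T
  proof -
    have "poly_hom 1 (s {i} T * pvar i)" for i
      using poly_hom_mult[OF s(1) poly_hom_pvar] by simp
    then have "ncomp (k + 1) (\<Sum>i\<in>- T. to_fract (s {i} T * pvar i) * \<omega> $ insert i T) =
        (\<Sum>i\<in>- T. to_fract (s {i} T * pvar i) * ncomp k (\<omega> $ insert i T))"
      using assms by (intro ncomp_linear_combination) (simp_all add: regular_def)
    then show ?thesis
      by (simp add: contract_euler_contract contract_component fcomp_def s(2))
  qed
  then show ?thesis by (simp add: vec_eq_iff)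
qed

lemma fcomp_d_linear_wedge:
  assumes "regular (Q *s \<omega>)"
  shows "d_linear c \<and>\<^sub>w fcomp k \<omega> = fcomp k (d_linear c \<and>\<^sub>w \<omega>)"
proof -
  obtain s where s: "\<And>S T. poly_hom 0 (s S T)" "\<And>S T. shuffle_sign S T = to_fract (s S T :: 'n pring)"
    using shuffle_sign_to_fract by metis
  define b :: "'n set \<Rightarrow> 'n pring" where "b S = (\<Sum>i\<in>UNIV. if S = {i} then pconst (c $ i) else 0)" for S
  have b: "d_linear c $ S = to_fract (b S)" "poly_hom 0 (b S)" for S
    by (auto simp: d_linear_def b_def if_distrib intro!: poly_hom_sum cong: if_cong)
  have "(d_linear c \<and>\<^sub>w fcomp k \<omega>) $ U = fcomp k (d_linear c \<and>\<^sub>w \<omega>) $ U" for U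
  proof -
    have "poly_hom 0 (s S (U - S) * b S)" for S
      using poly_hom_mult[OF s(1) b(2)] by simp
    then have "ncomp (k + 0) (\<Sum>S\<in>Pow U. to_fract (s S (U - S) * b S) * \<omega> $ (U - S)) =
        (\<Sum>S\<in>Pow U. to_fract (s S (U - S) * b S) * ncomp k (\<omega> $ (U - S)))"
      using assms by (intro ncomp_linear_combination) (simp_all add: regular_def)
    then show ?thesis
      by (simp add: wedge_component fcomp_def s(2) b(1))
  qed
  then show ?thesis by (simp add: vec_eq_iff)
qed

text \<open>The conditions that define \<open>C p\<close> are homogeneous: taking components commutes with \<open>\<iota>\<close> and with
  \<open>d\<alpha>\<^sub>H\<close>, and for \<open>d\<alpha>\<^sub>H/\<alpha>\<^sub>H\<close> the index drops by one because of the division by \<open>\<alpha>\<^sub>H\<close>.\<close>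

lemma fcomp_in_C:
  assumes "\<omega> \<in> C p"
  shows "fcomp k \<omega> \<in> C p"
proof -
  have deg: "of_degree p \<omega>" and reg: "regular (Q *s \<omega>)" and ker: "contract_euler \<omega> = 0"
    and log: "\<And>H. H \<in> A \<Longrightarrow> regular (Q *s (dlog (\<alpha> H) \<and>\<^sub>w \<omega>))"
    using assms by (auto simp: log_forms0_def log_forms_iff)
  have "contract_euler (fcomp k \<omega>) = 0"
    by (simp add: fcomp_contract_euler[OF reg] ker) (simp add: fcomp_def vec_eq_iff)
  moreover have "regular (Q *s fcomp k \<omega>)"
    by (simp add: regular_def fcomp_def)
  moreover have "regular (Q *s (dlog (\<alpha> H) \<and>\<^sub>w fcomp k \<omega>))" if H: "H \<in> A" for H
  proof -
    have "dlog (\<alpha> H) \<and>\<^sub>w fcomp k \<omega> = fcomp (k - 1) (dlog (\<alpha> H) \<and>\<^sub>w \<omega>)"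
    proof -
      have "lin H *s (dlog (\<alpha> H) \<and>\<^sub>w fcomp k \<omega>) = fcomp k (lin H *s (dlog (\<alpha> H) \<and>\<^sub>w \<omega>))"
        using fcomp_d_linear_wedge[OF reg, of "\<alpha> H" k]
        by (simp add: d_linear_eq_scale_dlog \<alpha>_nonzero H wedge_scale_left)
      also have "\<dots> = lin H *s fcomp (k - 1) (dlog (\<alpha> H) \<and>\<^sub>w \<omega>)"
        using ncomp_mult_hom[OF poly_hom_linear_poly[of "\<alpha> H"], where k = "k - 1"] log[OF H]
        by (simp add: vec_eq_iff fcomp_def regular_def)
      finally show ?thesis using lin_nonzero[OF H] by simp
    qed
    then show ?thesis by (simp add: regular_def fcomp_def)
  qed
  ultimately show ?thesis
    using deg by (simp add: log_forms0_def log_forms_iff fcomp_of_degree)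
qed

lemma form_hom_fcomp:
  assumes "of_degree p \<omega>"
  shows "form_hom (k - int (card A) + int p) (fcomp k \<omega>)"
proof -
  have "ratfun_hom (k - int (card A)) (ncomp k r)" for r
    using ratfun_hom_mult[OF ratfun_hom_to_fract[OF poly_hom_hcomp] ratfun_hom_inverse[OF ratfun_hom_Q]]
    by (simp add: ncomp_def field_simps)
  moreover have "ncomp k (\<omega> $ S) = 0" if "card S \<noteq> p" for S
    using that assms by (simp add: of_degree_def)
  ultimately show ?thesis
    unfolding form_hom_def fcomp_def by (metis add_diff_cancel_right' ratfun_hom_zero vec_lambda_beta)
qed

lemma sum_fcomp:
  assumes "regular (Q *s \<omega>)"
  shows "\<exists>D. finite D \<and> \<omega> = (\<Sum>k\<in>D. fcomp k \<omega>)"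
proof -
  define D where "D = (\<Union>S. (\<lambda>t. int (\<Sum>i\<in>UNIV. Poly_Mapping.lookup t i)) ` Poly_Mapping.keys (num (\<omega> $ S)))"
  have fin: "finite D" by (simp add: D_def)
  have "\<omega> $ S = (\<Sum>k\<in>D. fcomp k \<omega>) $ S" for S
  proof -
    have "(\<Sum>k\<in>D. hcomp k (num (\<omega> $ S))) = num (\<omega> $ S)"
      by (rule sum_hcomp[OF fin]) (auto simp: D_def)
    then have "(\<Sum>k\<in>D. to_fract (hcomp k (num (\<omega> $ S)))) = to_fract (num (\<omega> $ S))"
      by (metis to_fract_sum)
    also have "\<dots> = Q * \<omega> $ S"
      using assms by (intro to_fract_num[symmetric]) (simp add: regular_def)
    finally show ?thesis
      by (simp add: fcomp_def ncomp_def flip: sum_divide_distrib)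
  qed
  then have "\<omega> = (\<Sum>k\<in>D. fcomp k \<omega>)" unfolding vec_eq_iff ..
  with fin show ?thesis by blast
qed

lemma graded_submodule_C: "graded_submodule (C p)"
  unfolding graded_submodule_def
proof (intro conjI ballI allI)
  fix \<omega> assume \<omega>: "\<omega> \<in> C p"
  then have "regular (Q *s \<omega>)" and deg: "of_degree p \<omega>"
    by (simp_all add: log_forms0_def log_forms_iff)
  then obtain D where D: "finite D" "\<omega> = (\<Sum>k\<in>D. fcomp k \<omega>)"
    using sum_fcomp by blast
  define D' where "D' = (\<lambda>k. k - int (card A) + int p) ` D"
  define c where "c d = fcomp (d + int (card A) - int p) \<omega>" for d
  have "\<omega> = (\<Sum>d\<in>D'. c d)"
    unfolding D'_def by (subst sum.reindex) (simp_all add: inj_on_def c_def flip: D(2))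
  moreover have "form_hom d (c d)" for d
    using form_hom_fcomp[OF deg, of "d + int (card A) - int p"] by (simp add: c_def)
  moreover have "c d \<in> C p" for d
    unfolding c_def by (rule fcomp_in_C[OF \<omega>])
  moreover have "finite D'" using D by (simp add: D'_def)
  ultimately show "\<exists>D c. finite D \<and> (\<forall>d\<in>D. c d \<in> C p \<and> form_hom d (c d)) \<and> \<omega> = (\<Sum>d\<in>D. c d)"
    by blast
qed (auto intro: C_zero C_add C_pscale)

end

section \<open>Duality\<close>

lemma R_linear_on_zero: "R_linear_on M \<phi> \<Longrightarrow> 0 \<in> M \<Longrightarrow> \<phi> 0 = 0"
  unfolding R_linear_on_def by (metis mult_zero_left pscale_def to_fract_0 vector_smult_lzero)

lemma R_linear_on_sum:
  assumes "R_linear_on M \<phi>" "0 \<in> M" "\<And>\<omega> \<eta>. \<omega> \<in> M \<Longrightarrow> \<eta> \<in> M \<Longrightarrow> \<omega> + \<eta> \<in> M"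
    and "\<And>i. i \<in> I \<Longrightarrow> g i \<in> M"
  shows "\<phi> (\<Sum>i\<in>I. g i) = (\<Sum>i\<in>I. \<phi> (g i))"
proof -
  have "(\<Sum>i\<in>I. g i) \<in> M \<and> \<phi> (\<Sum>i\<in>I. g i) = (\<Sum>i\<in>I. \<phi> (g i))"
    using assms(4)
    by (induction I rule: infinite_finite_induct)
      (use assms(1-3) in \<open>auto simp: R_linear_on_zero R_linear_on_def\<close>)
  then show ?thesis ..
qed

lemma wedge_dx_top: "(\<omega> \<and>\<^sub>w dx T) $ UNIV = shuffle_sign (- T) T * \<omega> $ (- T)"
proof -
  have "(\<omega> \<and>\<^sub>w dx T) $ UNIV = (\<Sum>S\<in>UNIV. if S = - T then shuffle_sign (- T) T * \<omega> $ (- T) else 0)"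
    unfolding wedge_component by (intro sum.cong) (auto simp: dx_component simp flip: Compl_eq_Diff_UNIV)
  then show ?thesis by simp
qed

text \<open>As \<open>\<iota>(\<omega>) = 0\<close>, the Leibniz rule gives \<open>\<omega> \<and> \<iota>(\<zeta>) = (- 1)\<^sup>p \<iota>(\<omega> \<and> \<zeta>)\<close>, and \<open>\<omega> \<and> \<zeta>\<close> has top degree.\<close>

lemma wedge_contract_euler_top:
  fixes \<omega> :: "('n::{finite,linorder}) form"
  assumes "of_degree p \<omega>" "of_degree (Suc q) \<zeta>" "p + q = CARD('n) - 1" "contract_euler \<omega> = 0"
  shows "\<omega> \<and>\<^sub>w contract_euler \<zeta> = ((- 1) ^ p * (\<omega> \<and>\<^sub>w \<zeta>) $ UNIV) *s euler_volume"
proof -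
  have "p + Suc q = CARD('n)" using assms(3) by simp
  then have "of_degree CARD('n) (\<omega> \<and>\<^sub>w \<zeta>)"
    using of_degree_wedge[OF assms(1,2)] by simp
  then have top: "\<omega> \<and>\<^sub>w \<zeta> = (\<omega> \<and>\<^sub>w \<zeta>) $ UNIV *s dx UNIV" by (rule of_degree_top)
  have "(\<omega> \<and>\<^sub>w \<zeta>) $ UNIV *s euler_volume = contract_euler ((\<omega> \<and>\<^sub>w \<zeta>) $ UNIV *s dx UNIV)"
    by (simp add: contract_euler_contract contract_scale euler_volume_def)
  also have "\<dots> = contract_euler (\<omega> \<and>\<^sub>w \<zeta>)" by (simp flip: top)
  also have "\<dots> = (- 1) ^ p *s (\<omega> \<and>\<^sub>w contract_euler \<zeta>)"
    using assms(4) grade_involution_of_degree[OF assms(1)]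
    by (simp add: contract_euler_contract contract_wedge wedge_scale_left)
  finally have "(- 1) ^ p *s ((\<omega> \<and>\<^sub>w \<zeta>) $ UNIV *s euler_volume) = \<omega> \<and>\<^sub>w contract_euler \<zeta>"
    by (simp flip: power_mult_distrib)
  then show ?thesis by simp
qed

context arrangement
begin

lemma test_form_in_C: "card T = Suc q \<Longrightarrow> contract_euler (dx T) \<in> C q"
  using C_contract_euler[of "dx T" q] dx_log[of T] by simp

lemma wedge_test_form:
  assumes "\<omega> \<in> C p" "p + q = CARD('n) - 1" "card T = Suc q"
  shows "\<omega> \<and>\<^sub>w contract_euler (dx T) =
    ((- 1) ^ p * shuffle_sign (- T) T * \<omega> $ (- T)) *s euler_volume"
  using wedge_contract_euler_top[OF C_degree[OF assms(1)] _ assms(2) C_contract[OF assms(1)], of "dx T"]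
    of_degree_dx[of T] assms(3)
  by (simp add: wedge_dx_top mult.assoc)

lemma card_Compl_test:
  assumes "p + q = CARD('n) - 1" "card S = p"
  shows "card (- S :: 'n set) = Suc q"
proof -
  have "card (- S) = CARD('n) - p" using assms(2) by (simp add: Compl_eq_Diff_UNIV card_Diff_subset)
  then show ?thesis using assms(1) zero_less_card_finite[where 'a = 'n] by linarith
qed

lemma wedge_pairing_injective:
  assumes "\<omega> \<in> C p" "p + q = CARD('n) - 1" "\<And>\<eta>. \<eta> \<in> C q \<Longrightarrow> \<omega> \<and>\<^sub>w \<eta> = 0"
  shows "\<omega> = 0"
proof -
  have "\<omega> $ S = 0" for S
  proof (cases "card S = p")
    case True
    note c = card_Compl_test[OF assms(2) True]
    from wedge_test_form[OF assms(1,2) c] assms(3)[OF test_form_in_C[OF c]]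
    show ?thesis by simp
  qed (use C_degree[OF assms(1)] in \<open>simp add: of_degree_def\<close>)
  then show ?thesis by (simp add: vec_eq_iff)
qed

lemma wedge_pairing_detects_degree:
  assumes "\<omega> \<in> C p" "p + q = CARD('n) - 1"
    and "\<And>e \<eta>. \<eta> \<in> C q \<Longrightarrow> form_hom e \<eta> \<Longrightarrow> form_hom (d + e) (\<omega> \<and>\<^sub>w \<eta>)"
  shows "form_hom d \<omega>"
  unfolding form_hom_def
proof
  fix S
  show "ratfun_hom (d - int (card S)) (\<omega> $ S)"
  proof (cases "card S = p")
    case True
    note c = card_Compl_test[OF assms(2) True]
    have "form_hom (d + int (card (- S))) (\<omega> \<and>\<^sub>w contract_euler (dx (- S)))"
      by (intro assms(3) test_form_in_C c form_hom_contract_euler form_hom_dx)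
    then have "ratfun_hom (d + int (card (- S)) - int CARD('n)) ((- 1) ^ p * shuffle_sign S (- S) * \<omega> $ S)"
      by (simp add: wedge_test_form[OF assms(1,2) c] form_hom_euler_volume_iff)
    moreover have "d + int (card (- S)) - int CARD('n) = d - int (card S)"
      using c assms(2) True zero_less_card_finite[where 'a = 'n] by linarith
    ultimately have "ratfun_hom (d - int (card S) + (0 + 0)) (\<omega> $ S * ((- 1) ^ p * shuffle_sign S (- S)))"
      by (simp add: ac_simps)
    then show ?thesis
      by (rule ratfun_hom_cancel) (intro ratfun_hom_mult ratfun_hom_sign ratfun_hom_shuffle_sign, simp)
  qed (use C_degree[OF assms(1)] in \<open>simp add: of_degree_def\<close>)
qed

text \<open>By \<open>wedge_test_form\<close> the coefficients of \<open>\<omega>\<close> are forced by the values of \<open>\<phi>\<close> at the forms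
  \<open>\<iota>(dx\<^sub>T)\<close>. The form so defined satisfies \<open>top(\<omega> \<and> \<zeta>) = (- 1)\<^sup>p \<phi>(\<iota>(\<zeta>)) / f\<close> for \<open>\<zeta> = dx\<^sub>T\<close>, where
  \<open>top\<close> is the coefficient at \<open>vol\<close>. By linearity this holds for all rational \<open>(q + 1)\<close>-forms \<open>\<zeta>\<close> with
  \<open>\<iota>(\<zeta>)\<close> in \<open>C q\<close>, and each property of \<open>\<omega>\<close> results from a choice of \<open>\<zeta>\<close>:
  \<open>\<iota>(dx\<^sub>T)\<close> gives \<open>\<iota>(\<omega>) = 0\<close>, since \<open>\<iota>\<close> has square zero;
  \<open>d\<alpha>\<^sub>H/\<alpha>\<^sub>H \<and> dx\<^sub>T\<close> gives that \<open>\<omega>\<close> is logarithmic; and \<open>d\<alpha>\<^sub>H/\<alpha>\<^sub>H \<and> \<eta>\<close> gives that \<open>\<omega>\<close> represents \<open>\<phi>\<close>.\<close>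

lemma wedge_pairing_surjective:
  assumes pq: "p + q = CARD('n) - 1" and \<phi>: "R_linear_on (C q) \<phi>"
  shows "\<exists>\<omega>\<in>C p. \<forall>\<eta>\<in>C q. \<omega> \<and>\<^sub>w \<eta> = pscale (\<phi> \<eta>) generator"
proof -
  have add: "\<phi> (\<omega> + \<eta>) = \<phi> \<omega> + \<phi> \<eta>" if "\<omega> \<in> C q" "\<eta> \<in> C q" for \<omega> \<eta>
    using \<phi> that by (auto simp: R_linear_on_def)
  have scale: "\<phi> (pscale r \<omega>) = r * \<phi> \<omega>" if "\<omega> \<in> C q" for r \<omega>
    using \<phi> that by (auto simp: R_linear_on_def)
  define \<omega> :: "'n form" where
    "\<omega> = (\<chi> S. if card S = p
      then (- 1) ^ p * shuffle_sign S (- S) * to_fract (\<phi> (contract_euler (dx (- S)))) / Q else 0)"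
  have deg: "of_degree p \<omega>" by (simp add: of_degree_def \<omega>_def)
  have basic: "(\<omega> \<and>\<^sub>w dx T) $ UNIV = (- 1) ^ p * to_fract (\<phi> (contract_euler (dx T))) / Q"
    if "card T = Suc q" for T
  proof -
    have "card (- T) = CARD('n) - Suc q" using that by (simp add: Compl_eq_Diff_UNIV card_Diff_subset)
    then have "card (- T) = p" using pq by simp
    then show ?thesis by (simp add: wedge_dx_top \<omega>_def)
  qed
  have top_regular: "(\<omega> \<and>\<^sub>w \<zeta>) $ UNIV = (- 1) ^ p * to_fract (\<phi> (contract_euler \<zeta>)) / Q"
    if \<zeta>: "regular \<zeta>" "of_degree (Suc q) \<zeta>" for \<zeta>
  proof -
    have "\<forall>T. \<exists>r. \<zeta> $ T = to_fract r"
      using \<zeta>(1) by (auto simp: regular_def is_poly_def)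
    then obtain r where r: "\<And>T. \<zeta> $ T = to_fract (r T)" by metis
    let ?I = "{T. card T = Suc q}"
    have \<zeta>_eq: "\<zeta> = (\<Sum>T\<in>?I. pscale (r T) (dx T))"
    proof -
      have "\<zeta> = (\<Sum>T\<in>UNIV. \<zeta> $ T *s dx T)" by (rule form_expansion)
      also have "\<dots> = (\<Sum>T\<in>?I. \<zeta> $ T *s dx T)"
        using \<zeta>(2) by (intro sum.mono_neutral_right) (auto simp: of_degree_def)
      finally show ?thesis by (simp add: pscale_def r)
    qed
    have 1: "contract_euler \<zeta> = (\<Sum>T\<in>?I. pscale (r T) (contract_euler (dx T)))"
      by (subst \<zeta>_eq) (simp add: contract_euler_contract contract_sum contract_scale pscale_def)
    have "\<phi> (contract_euler \<zeta>) = (\<Sum>T\<in>?I. \<phi> (pscale (r T) (contract_euler (dx T))))"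
      unfolding 1 by (rule R_linear_on_sum[OF \<phi> C_zero C_add]) (auto intro: C_pscale test_form_in_C)
    also have "\<dots> = (\<Sum>T\<in>?I. r T * \<phi> (contract_euler (dx T)))"
      by (intro sum.cong refl scale) (simp add: test_form_in_C)
    finally have 2: "\<phi> (contract_euler \<zeta>) = (\<Sum>T\<in>?I. r T * \<phi> (contract_euler (dx T)))" .
    have "(\<omega> \<and>\<^sub>w \<zeta>) $ UNIV = (\<Sum>T\<in>?I. to_fract (r T) * (\<omega> \<and>\<^sub>w dx T) $ UNIV)"
      by (subst \<zeta>_eq) (simp add: wedge_sum_right pscale_def wedge_scale_right)
    also have "\<dots> = (- 1) ^ p * to_fract (\<phi> (contract_euler \<zeta>)) / Q"
      unfolding 2 by (simp add: basic sum_distrib_left sum_divide_distrib ac_simps)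
    finally show ?thesis .
  qed
  have top: "(\<omega> \<and>\<^sub>w \<zeta>) $ UNIV = (- 1) ^ p * to_fract (\<phi> (contract_euler \<zeta>)) / Q"
    if \<zeta>: "of_degree (Suc q) \<zeta>" "contract_euler \<zeta> \<in> C q" and h: "h \<noteq> 0" "regular (to_fract h *s \<zeta>)" for \<zeta> h
  proof -
    have "to_fract h * (\<omega> \<and>\<^sub>w \<zeta>) $ UNIV = (\<omega> \<and>\<^sub>w (to_fract h *s \<zeta>)) $ UNIV"
      by (simp add: wedge_scale_right)
    also have "\<dots> = (- 1) ^ p * to_fract (\<phi> (contract_euler (to_fract h *s \<zeta>))) / Q"
      by (intro top_regular h of_degree_scale \<zeta>)
    also have "contract_euler (to_fract h *s \<zeta>) = pscale h (contract_euler \<zeta>)"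
      by (simp add: contract_euler_contract contract_scale pscale_def)
    also have "\<phi> \<dots> = h * \<phi> (contract_euler \<zeta>)" by (rule scale[OF \<zeta>(2)])
    finally have "to_fract h * (\<omega> \<and>\<^sub>w \<zeta>) $ UNIV = to_fract h * ((- 1) ^ p * to_fract (\<phi> (contract_euler \<zeta>)) / Q)"
      by (simp add: ac_simps)
    moreover have "to_fract h \<noteq> 0" using h(1) by simp
    ultimately show ?thesis by (metis mult_left_cancel)
  qed
  have kernel: "contract_euler \<omega> = 0"
  proof -
    have "contract_euler \<omega> $ S = 0" for S
    proof (cases "Suc (card S) = p")
      case False
      then have "card (insert i S) \<noteq> p" if "i \<notin> S" for i using that by simp
      then show ?thesis
        using deg by (auto simp: contract_euler_contract contract_component of_degree_def intro!: sum.neutral)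
    next
      case True
      let ?T = "- S"
      have cT: "card ?T = Suc (Suc q)"
        using card_Compl_test[of "card S" "Suc q" S] True pq by simp
      have "of_degree (p + Suc (Suc q)) (\<omega> \<and>\<^sub>w dx ?T)"
        using of_degree_wedge[OF deg of_degree_dx] cT by metis
      \<comment> \<open>For degree reasons, so that the Leibniz rule trades \<open>\<iota>(\<omega>) \<and> dx\<^sub>T\<close> for \<open>\<omega> \<and> \<iota>(dx\<^sub>T)\<close>.\<close>
      then have "\<omega> \<and>\<^sub>w dx ?T = 0" by (rule of_degree_above_top) (use pq in simp)
      then have "contract_euler (\<omega> \<and>\<^sub>w dx ?T) = 0" by (simp add: contract_euler_contract)
      then have "contract_euler \<omega> \<and>\<^sub>w dx ?T + (- 1) ^ p *s (\<omega> \<and>\<^sub>w contract_euler (dx ?T)) = 0"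
        by (simp add: contract_euler_contract contract_wedge grade_involution_of_degree[OF deg] wedge_scale_left)
      then have "(contract_euler \<omega> \<and>\<^sub>w dx ?T) $ UNIV + (- 1) ^ p * (\<omega> \<and>\<^sub>w contract_euler (dx ?T)) $ UNIV = 0"
        by (metis vector_add_component vector_smult_component zero_index)
      moreover have "(\<omega> \<and>\<^sub>w contract_euler (dx ?T)) $ UNIV = 0"
      proof -
        have "of_degree (Suc q) (contract_euler (dx ?T))"
          using of_degree_dx[of ?T] cT by (simp add: contract_euler_contract of_degree_contract)
        moreover have "regular (contract_euler (dx ?T))"
          unfolding contract_euler_contract by (rule regular_contract) simp_all
        ultimately have "(\<omega> \<and>\<^sub>w contract_euler (dx ?T)) $ UNIV =
            (- 1) ^ p * to_fract (\<phi> (contract_euler (contract_euler (dx ?T)))) / Q"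
          by (intro top_regular)
        also have "contract_euler (contract_euler (dx ?T)) = 0" by (simp add: contract_euler_contract)
        finally show ?thesis using R_linear_on_zero[OF \<phi> C_zero] by simp
      qed
      ultimately show ?thesis by (simp add: wedge_dx_top)
    qed
    then show ?thesis by (simp add: vec_eq_iff)
  qed
  have poly_sign: "is_poly (Q * ((- 1) ^ p * to_fract r / Q))" for r
    by (simp add: is_poly_mult)
  have "regular (Q *s \<omega>)"
    unfolding regular_def by (auto simp: \<omega>_def intro!: is_poly_mult)
  moreover have "regular (Q *s (dlog (\<alpha> H) \<and>\<^sub>w \<omega>))" if H: "H \<in> A" for H
    unfolding regular_def
  proof
    fix S
    have degd: "of_degree (Suc p) (dlog (\<alpha> H) \<and>\<^sub>w \<omega>)"
      using of_degree_wedge[OF of_degree_dlog deg] by simp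
    show "is_poly ((Q *s (dlog (\<alpha> H) \<and>\<^sub>w \<omega>)) $ S)"
    proof (cases "card S = Suc p")
      case False
      with degd show ?thesis by (simp add: of_degree_def)
    next
      case True
      let ?T = "- S" and ?\<zeta> = "dlog (\<alpha> H) \<and>\<^sub>w dx (- S)"
      have cT: "card ?T = q"
        using True pq by (simp add: Compl_eq_Diff_UNIV card_Diff_subset)
      have \<zeta>: "?\<zeta> \<in> log_forms A \<alpha> (Suc q)"
        using dlog_wedge_dx_log[OF H, of ?T] cT by simp
      have "(\<omega> \<and>\<^sub>w ?\<zeta>) $ UNIV = (- 1) ^ p * to_fract (\<phi> (contract_euler ?\<zeta>)) / Q"
      proof (rule top)
        show "of_degree (Suc q) ?\<zeta>" using \<zeta> by (simp add: log_forms_iff)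
        show "contract_euler ?\<zeta> \<in> C q" by (rule C_contract_euler[OF \<zeta>])
        show "linear_poly (\<alpha> H) \<noteq> 0" by (simp add: linear_poly_nonzero \<alpha>_nonzero H)
        have "lin H *s ?\<zeta> = d_linear (\<alpha> H) \<and>\<^sub>w dx ?T"
          by (simp add: d_linear_eq_scale_dlog \<alpha>_nonzero H wedge_scale_left)
        then show "regular (lin H *s ?\<zeta>)" by (simp add: regular_wedge)
      qed
      then have poly: "is_poly (Q * (\<omega> \<and>\<^sub>w ?\<zeta>) $ UNIV)" by (simp only: poly_sign)
      have "dlog (\<alpha> H) \<and>\<^sub>w \<omega> = (- 1) ^ p *s (\<omega> \<and>\<^sub>w dlog (\<alpha> H))"
        using wedge_graded_commute[OF of_degree_dlog deg] by simp
      then have "(dlog (\<alpha> H) \<and>\<^sub>w \<omega>) \<and>\<^sub>w dx ?T = (- 1) ^ p *s (\<omega> \<and>\<^sub>w ?\<zeta>)"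
        by (simp add: wedge_scale_left wedge_assoc)
      then have "((dlog (\<alpha> H) \<and>\<^sub>w \<omega>) \<and>\<^sub>w dx ?T) $ UNIV = (- 1) ^ p * (\<omega> \<and>\<^sub>w ?\<zeta>) $ UNIV"
        by simp
      then have eq: "shuffle_sign S (- S) * (dlog (\<alpha> H) \<and>\<^sub>w \<omega>) $ S = (- 1) ^ p * (\<omega> \<and>\<^sub>w ?\<zeta>) $ UNIV"
        by (simp add: wedge_dx_top)
      have "(dlog (\<alpha> H) \<and>\<^sub>w \<omega>) $ S = shuffle_sign S (- S) * (shuffle_sign S (- S) * (dlog (\<alpha> H) \<and>\<^sub>w \<omega>) $ S)"
        by (simp add: mult.assoc[symmetric])
      then have "(Q *s (dlog (\<alpha> H) \<and>\<^sub>w \<omega>)) $ S = shuffle_sign S (- S) * (- 1) ^ p * (Q * (\<omega> \<and>\<^sub>w ?\<zeta>) $ UNIV)"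
        by (simp add: eq ac_simps)
      then show ?thesis
        using is_poly_mult[OF is_poly_mult[OF is_poly_shuffle_sign is_poly_sign] poly] by (simp only:)
    qed
  qed
  ultimately have \<omega>C: "\<omega> \<in> C p"
    using deg kernel by (simp add: log_forms0_def log_forms_iff)
  moreover have "\<omega> \<and>\<^sub>w \<eta> = pscale (\<phi> \<eta>) generator" if \<eta>: "\<eta> \<in> C q" for \<eta>
  proof -
    from nonempty obtain H where H: "H \<in> A" by blast
    let ?\<zeta> = "dlog (\<alpha> H) \<and>\<^sub>w \<eta>"
    have deg\<zeta>: "of_degree (Suc q) ?\<zeta>"
      using of_degree_wedge[OF of_degree_dlog C_degree[OF \<eta>]] by simp
    have \<eta>_eq: "contract_euler ?\<zeta> = \<eta>" using C_eq_contract_dlog[OF \<eta> H] by simp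
    have "regular (to_fract (defining_poly A \<alpha>) *s ?\<zeta>)"
      using \<eta> H by (auto simp: log_forms0_def log_forms_iff simp flip: Q_def)
    moreover have "defining_poly A \<alpha> \<noteq> 0" using Q_nonzero by (auto simp: Q_def)
    ultimately have "(\<omega> \<and>\<^sub>w ?\<zeta>) $ UNIV = (- 1) ^ p * to_fract (\<phi> \<eta>) / Q"
      using top[OF deg\<zeta>] \<eta> by (simp add: \<eta>_eq)
    then have "\<omega> \<and>\<^sub>w \<eta> = ((- 1) ^ p * ((- 1) ^ p * to_fract (\<phi> \<eta>) / Q)) *s euler_volume"
      using wedge_contract_euler_top[OF deg deg\<zeta> pq kernel] by (simp add: \<eta>_eq)
    also have "(- 1) ^ p * ((- 1) ^ p * to_fract (\<phi> \<eta>) / Q) = to_fract (\<phi> \<eta>) * inverse Q"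
      by (simp add: field_simps flip: power_mult_distrib mult.assoc)
    finally show ?thesis by (simp add: pscale_def generator_def)
  qed
  ultimately show ?thesis by blast
qed

abbreviation shift :: int where
  "shift \<equiv> int (card A) - int CARD('n)"

lemma C_wedge_top: "p + q = CARD('n) - 1 \<Longrightarrow> \<omega> \<in> C p \<Longrightarrow> \<eta> \<in> C q \<Longrightarrow> \<omega> \<and>\<^sub>w \<eta> \<in> C (CARD('n) - 1)"
  using C_wedge by metis

lemma pairing_linear:
  assumes "R_linear_on (C (CARD('n) - 1)) \<psi>" "p + q = CARD('n) - 1"
  shows "\<omega> \<in> C p \<Longrightarrow> R_linear_on (C q) (\<lambda>\<eta>. \<psi> (\<omega> \<and>\<^sub>w \<eta>))"
    and "\<eta> \<in> C q \<Longrightarrow> R_linear_on (C p) (\<lambda>\<omega>. \<psi> (\<omega> \<and>\<^sub>w \<eta>))"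
  using assms(1) C_wedge_top[OF assms(2)]
  by (auto simp: R_linear_on_def wedge_add_right wedge_add_left pscale_def wedge_scale_right wedge_scale_left)

theorem wedge_graded_iso_dual:
  assumes \<psi>: "graded_iso_shift (C (CARD('n) - 1)) shift \<psi>" and pq: "p + q = CARD('n) - 1"
  shows "graded_iso_dual (C p) (C q) shift (\<lambda>\<omega>. restrict (\<lambda>\<eta>. \<psi> (\<omega> \<and>\<^sub>w \<eta>)) (C q))"
proof -
  let ?top = "C (CARD('n) - 1)" and ?\<Phi> = "\<lambda>\<omega>. restrict (\<lambda>\<eta>. \<psi> (\<omega> \<and>\<^sub>w \<eta>)) (C q)"
  have lin: "R_linear_on ?top \<psi>" and bij: "bij_betw \<psi> ?top UNIV"
    and hom: "\<And>d \<omega>. \<omega> \<in> ?top \<Longrightarrow> form_hom d \<omega> \<longleftrightarrow> poly_hom (shift + d) (\<psi> \<omega>)"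
    using \<psi> by (auto simp: graded_iso_shift_def)
  have "R_linear_on (C p) (\<lambda>\<omega>. ?\<Phi> \<omega> \<eta>)" if "\<eta> \<in> C q" for \<eta>
    using pairing_linear(2)[OF lin pq that] that by simp
  moreover have "bij_betw ?\<Phi> (C p) (dual_module (C q))"
    unfolding bij_betw_def
  proof
    show "inj_on ?\<Phi> (C p)"
    proof (rule inj_onI)
      fix \<omega> \<omega>' assume \<omega>: "\<omega> \<in> C p" "\<omega>' \<in> C p" and eq: "?\<Phi> \<omega> = ?\<Phi> \<omega>'"
      have "(\<omega> - \<omega>') \<and>\<^sub>w \<eta> = 0" if \<eta>: "\<eta> \<in> C q" for \<eta>
      proof -
        have "\<psi> (\<omega> \<and>\<^sub>w \<eta>) = \<psi> (\<omega>' \<and>\<^sub>w \<eta>)" using fun_cong[OF eq, of \<eta>] \<eta> by simp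
        then have "\<omega> \<and>\<^sub>w \<eta> = \<omega>' \<and>\<^sub>w \<eta>"
          using inj_onD[OF bij_betw_imp_inj_on[OF bij]] C_wedge_top[OF pq] \<omega> \<eta> by blast
        then show ?thesis using wedge_add_left[of "\<omega> - \<omega>'" \<omega>' \<eta>] by simp
      qed
      from wedge_pairing_injective[OF C_diff[OF \<omega>] pq this] show "\<omega> = \<omega>'" by simp
    qed
    show "?\<Phi> ` C p = dual_module (C q)"
    proof (intro equalityI subsetI)
      fix \<phi> assume "\<phi> \<in> ?\<Phi> ` C p"
      then show "\<phi> \<in> dual_module (C q)"
        using pairing_linear(1)[OF lin pq] C_add C_pscale
        by (auto simp: dual_module_def R_linear_on_def)
    next
      fix \<phi> assume "\<phi> \<in> dual_module (C q)"
      then have \<phi>: "R_linear_on (C q) \<phi>" "\<phi> \<in> extensional (C q)" by (auto simp: dual_module_def)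
      \<comment> \<open>The given \<open>\<psi>\<close> need not send the generator to \<open>1\<close>; rescaling \<open>\<phi>\<close> by the coordinate \<open>c\<close> of
        \<open>\<psi>\<^sup>-\<^sup>1(1)\<close> corrects for this.\<close>
      obtain \<tau> where \<tau>: "\<tau> \<in> ?top" "\<psi> \<tau> = 1"
        using bij by (metis UNIV_I bij_betw_imp_surj_on imageE)
      obtain c where c: "\<tau> = pscale c generator" using C_top_generated[OF \<tau>(1)] by blast
      have "R_linear_on (C q) (\<lambda>\<eta>. c * \<phi> \<eta>)"
        using \<phi>(1) by (auto simp: R_linear_on_def algebra_simps)
      from wedge_pairing_surjective[OF pq this] obtain \<omega> where
        \<omega>: "\<omega> \<in> C p" "\<And>\<eta>. \<eta> \<in> C q \<Longrightarrow> \<omega> \<and>\<^sub>w \<eta> = pscale (c * \<phi> \<eta>) generator"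
        by blast
      have "\<psi> (\<omega> \<and>\<^sub>w \<eta>) = \<phi> \<eta>" if "\<eta> \<in> C q" for \<eta>
      proof -
        have "\<omega> \<and>\<^sub>w \<eta> = pscale (\<phi> \<eta>) \<tau>"
          using \<omega>(2)[OF that] by (simp add: c pscale_def mult.commute)
        then show ?thesis using lin \<tau> by (simp add: R_linear_on_def)
      qed
      then have "?\<Phi> \<omega> = \<phi>" using \<phi>(2) by (auto simp: fun_eq_iff extensional_def)
      then show "\<phi> \<in> ?\<Phi> ` C p" using \<omega>(1) by blast
    qed
  qed
  moreover have "form_hom d \<omega> \<longleftrightarrow> dual_hom (C q) shift d (?\<Phi> \<omega>)" if \<omega>: "\<omega> \<in> C p" for d \<omega>
  proof
    assume d: "form_hom d \<omega>"
    show "dual_hom (C q) shift d (?\<Phi> \<omega>)"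
      unfolding dual_hom_def
    proof (intro allI ballI impI)
      fix e \<eta> assume "\<eta> \<in> C q" "form_hom e \<eta>"
      then show "poly_hom (shift + (d + e)) (?\<Phi> \<omega> \<eta>)"
        using hom[OF C_wedge_top[OF pq \<omega>], of \<eta> "d + e"] form_hom_wedge[OF d] by simp
    qed
  next
    assume "dual_hom (C q) shift d (?\<Phi> \<omega>)"
    then show "form_hom d \<omega>"
      using hom[OF C_wedge_top[OF pq \<omega>]]
      by (intro wedge_pairing_detects_degree[OF \<omega> pq]) (simp add: dual_hom_def)
  qed
  ultimately show ?thesis unfolding graded_iso_dual_def by blast
qed

text \<open>Used to absorb the sign for exchanging the two factors of the pairing.\<close>

lemma graded_iso_shift_sign:
  fixes M :: "'n form set"
  assumes "graded_iso_shift M m \<psi>" "s \<in> {1, - 1}"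
  shows "graded_iso_shift M m (\<lambda>\<omega>. s * \<psi> \<omega>)"
proof -
  have ss: "s * (s * r) = r" for r using assms(2) by auto
  have "bij_betw (\<lambda>r. s * r) (UNIV :: 'n pring set) UNIV"
    by (rule bij_betwI[where g = "\<lambda>r. s * r"]) (simp_all add: ss)
  with assms(1) have "bij_betw (\<lambda>\<omega>. s * \<psi> \<omega>) M UNIV"
    by (auto simp: graded_iso_shift_def comp_def dest: bij_betw_trans)
  moreover have "poly_hom d (s * r) \<longleftrightarrow> poly_hom d r" for d r
    using assms(2) by (auto simp: poly_hom_def)
  ultimately show ?thesis
    using assms(1) by (simp add: graded_iso_shift_def R_linear_on_def distrib_left mult.left_commute)
qed

theorem wedge_nondegenerate_pairing:
  assumes \<psi>: "graded_iso_shift (C (CARD('n) - 1)) shift \<psi>" and pq: "p + q = CARD('n) - 1"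
  shows "nondegenerate_pairing (C p) (C q) shift (\<lambda>\<omega> \<eta>. \<psi> (\<omega> \<and>\<^sub>w \<eta>))"
proof -
  have lin: "R_linear_on (C (CARD('n) - 1)) \<psi>"
    and hom: "\<And>d \<omega>. \<omega> \<in> C (CARD('n) - 1) \<Longrightarrow> form_hom d \<omega> \<longleftrightarrow> poly_hom (shift + d) (\<psi> \<omega>)"
    using \<psi> by (auto simp: graded_iso_shift_def)
  have "graded_pairing (C p) (C q) shift (\<lambda>\<omega> \<eta>. \<psi> (\<omega> \<and>\<^sub>w \<eta>))"
    unfolding graded_pairing_def
  proof (intro conjI ballI allI impI graded_submodule_C pairing_linear[OF lin pq])
    fix d e \<omega> \<eta> assume "\<omega> \<in> C p" "\<eta> \<in> C q" "form_hom d \<omega>" "form_hom e \<eta>"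
    then show "poly_hom (shift + (d + e)) (\<psi> (\<omega> \<and>\<^sub>w \<eta>))"
      using hom[OF C_wedge_top[OF pq], of \<omega> \<eta> "d + e"] form_hom_wedge[of d \<omega> e \<eta>] by simp
  qed
  moreover have "graded_iso_dual (C q) (C p) shift (\<lambda>\<eta>. restrict (\<lambda>\<omega>. \<psi> (\<omega> \<and>\<^sub>w \<eta>)) (C p))"
  proof -
    define s :: "'n pring" where "s = (- 1) ^ (p * q)"
    have s: "s \<in> {1, - 1}" by (cases "even (p * q)") (simp_all add: s_def)
    have "graded_iso_dual (C q) (C p) shift (\<lambda>\<eta>. restrict (\<lambda>\<omega>. s * \<psi> (\<eta> \<and>\<^sub>w \<omega>)) (C p))"
      using wedge_graded_iso_dual[OF graded_iso_shift_sign[OF \<psi> s], of q p] pq by simp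
    moreover have "s * \<psi> (\<eta> \<and>\<^sub>w \<omega>) = \<psi> (\<omega> \<and>\<^sub>w \<eta>)" if "\<eta> \<in> C q" "\<omega> \<in> C p" for \<eta> \<omega>
    proof -
      have "\<omega> \<and>\<^sub>w \<eta> = pscale s (\<eta> \<and>\<^sub>w \<omega>)"
        using wedge_graded_commute[OF C_degree[OF that(2)] C_degree[OF that(1)]]
        by (cases "even (p * q)") (simp_all add: s_def pscale_def)
      then show ?thesis
        using lin C_wedge_top[of q p, OF _ that] pq by (simp add: R_linear_on_def)
    qed
    ultimately show ?thesis
      unfolding graded_iso_dual_def
      by (simp add: R_linear_on_def dual_hom_def C_add C_pscale cong: restrict_cong bij_betw_cong)
  qed
  ultimately show ?thesis
    using wedge_graded_iso_dual[OF \<psi> pq] by (simp add: nondegenerate_pairing_def)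
qed

theorem wedge_omega_self_dual:
  assumes \<psi>: "graded_iso_shift (C (CARD('n) - 1)) shift \<psi>" and lam: "(\<Sum>H\<in>A. lam H) = 0"
  shows "self_dual_via (CARD('n) - 1) C (\<lambda>\<omega>. omega_weight A \<alpha> lam \<and>\<^sub>w \<omega>) shift
    (\<lambda>p \<omega>. restrict (\<lambda>\<eta>. \<psi> (\<omega> \<and>\<^sub>w \<eta>)) (C (CARD('n) - 1 - p)))"
proof -
  let ?w = "omega_weight A \<alpha> lam"
  have w: "?w \<in> C 1" by (rule omega_weight_in_C[OF lam])
  have w1: "of_degree 1 ?w" by (rule C_degree[OF w])
  have lin: "R_linear_on (C (CARD('n) - 1)) \<psi>" using \<psi> by (simp add: graded_iso_shift_def)
  have d: "?w \<and>\<^sub>w \<omega> \<in> C (Suc p)" if "\<omega> \<in> C p" for p \<omega>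
    using C_wedge[OF w that] by simp
  have "?w \<and>\<^sub>w ?w \<and>\<^sub>w \<omega> = 0" for \<omega>
    using of_degree_one_square_zero[OF w1] by (metis wedge_assoc wedge_zero_left)
  moreover have "form_hom e (?w \<and>\<^sub>w \<omega>)" if "form_hom e \<omega>" for e \<omega>
    using form_hom_wedge[OF form_hom_omega_weight that] by simp
  ultimately have "graded_complex (CARD('n) - 1) C (\<lambda>\<omega>. ?w \<and>\<^sub>w \<omega>)"
    unfolding graded_complex_def
    using d by (auto simp: graded_submodule_C C_above_top wedge_add_right pscale_def wedge_scale_right)
  moreover have "graded_iso_dual (C p) (C (CARD('n) - 1 - p)) shift
      (\<lambda>\<omega>. restrict (\<lambda>\<eta>. \<psi> (\<omega> \<and>\<^sub>w \<eta>)) (C (CARD('n) - 1 - p)))" if "p \<le> CARD('n) - 1" for p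
    using that by (intro wedge_graded_iso_dual[OF \<psi>]) simp
  moreover have "\<exists>s\<in>{1, - 1}. \<forall>\<omega>\<in>C p.
      restrict (\<lambda>\<eta>. \<psi> ((?w \<and>\<^sub>w \<omega>) \<and>\<^sub>w \<eta>)) (C (CARD('n) - 1 - Suc p)) =
      restrict (\<lambda>\<eta>. s * restrict (\<lambda>\<eta>. \<psi> (\<omega> \<and>\<^sub>w \<eta>)) (C (CARD('n) - 1 - p)) (?w \<and>\<^sub>w \<eta>))
        (C (CARD('n) - 1 - Suc p))" if p: "p < CARD('n) - 1" for p
  proof -
    define s :: "'n pring" where "s = (- 1) ^ p"
    have s: "s \<in> {1, - 1}" by (cases "even p") (simp_all add: s_def)
    have eq: "\<psi> ((?w \<and>\<^sub>w \<omega>) \<and>\<^sub>w \<eta>) = s * \<psi> (\<omega> \<and>\<^sub>w ?w \<and>\<^sub>w \<eta>)"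
      and in_C: "?w \<and>\<^sub>w \<eta> \<in> C (CARD('n) - 1 - p)"
      if \<omega>: "\<omega> \<in> C p" and \<eta>: "\<eta> \<in> C (CARD('n) - 1 - Suc p)" for \<omega> \<eta>
    proof -
      have k: "Suc (CARD('n) - 1 - Suc p) = CARD('n) - 1 - p" using p by simp
      show w\<eta>: "?w \<and>\<^sub>w \<eta> \<in> C (CARD('n) - 1 - p)" using d[OF \<eta>] unfolding k .
      have "?w \<and>\<^sub>w \<omega> = (- 1) ^ p *s (\<omega> \<and>\<^sub>w ?w)"
        using wedge_graded_commute[OF w1 C_degree[OF \<omega>]] by simp
      then have "(?w \<and>\<^sub>w \<omega>) \<and>\<^sub>w \<eta> = (- 1) ^ p *s (\<omega> \<and>\<^sub>w ?w \<and>\<^sub>w \<eta>)"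
        by (simp add: wedge_scale_left wedge_assoc)
      then have "(?w \<and>\<^sub>w \<omega>) \<and>\<^sub>w \<eta> = pscale s (\<omega> \<and>\<^sub>w ?w \<and>\<^sub>w \<eta>)"
        by (cases "even p") (simp_all add: s_def pscale_def)
      moreover have "\<omega> \<and>\<^sub>w ?w \<and>\<^sub>w \<eta> \<in> C (CARD('n) - 1)"
        using p by (intro C_wedge_top[OF _ \<omega> w\<eta>]) simp
      ultimately show "\<psi> ((?w \<and>\<^sub>w \<omega>) \<and>\<^sub>w \<eta>) = s * \<psi> (\<omega> \<and>\<^sub>w ?w \<and>\<^sub>w \<eta>)"
        using lin by (simp add: R_linear_on_def)
    qed
    show ?thesis
    proof (intro bexI[of _ s] ballI restrict_ext s)
      fix \<omega> \<eta> assume "\<omega> \<in> C p" "\<eta> \<in> C (CARD('n) - 1 - Suc p)"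
      then show "\<psi> ((?w \<and>\<^sub>w \<omega>) \<and>\<^sub>w \<eta>) =
          s * restrict (\<lambda>\<eta>. \<psi> (\<omega> \<and>\<^sub>w \<eta>)) (C (CARD('n) - 1 - p)) (?w \<and>\<^sub>w \<eta>)"
        by (simp only: eq in_C restrict_apply if_True)
    qed
  qed
  ultimately show ?thesis unfolding self_dual_via_def by blast
qed

end

lemma arrangement_of_central_essential:
  fixes A :: "('n::{finite,linorder}) cvec set set"
  assumes "central_essential_arrangement A" "defining_forms A \<alpha>"
  shows "arrangement A \<alpha>"
proof
  show "finite A" using assms(1) by (simp add: central_essential_arrangement_def)
  show "\<alpha> H \<noteq> 0" "linear_kernel (\<alpha> H) = H" if "H \<in> A" for H
    using assms(2) that unfolding defining_forms_def by auto
  show "A \<noteq> {}"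
  proof
    assume "A = {}"
    then have "(UNIV :: 'n cvec set) = {0}"
      using assms(1) by (simp add: central_essential_arrangement_def)
    then have "(1 :: 'n cvec) = 0" by blast
    then show False by simp
  qed
qed

theorem proposition3p8:
  fixes A :: "('n::{finite,linorder}) cvec set set"
    and \<alpha> :: "'n cvec set \<Rightarrow> 'n cvec"
  assumes "central_essential_arrangement A"
    and "defining_forms A \<alpha>"
  shows "(\<exists>\<psi>. graded_iso_shift (log_forms0 A \<alpha> (CARD('n) - 1)) (int (card A) - int CARD('n)) \<psi>) \<and>
    (\<forall>\<psi>. graded_iso_shift (log_forms0 A \<alpha> (CARD('n) - 1)) (int (card A) - int CARD('n)) \<psi> \<longrightarrow>
      (\<forall>p q. p + q = CARD('n) - 1 \<longrightarrow>
        (\<forall>\<omega>\<in>log_forms0 A \<alpha> p. \<forall>\<eta>\<in>log_forms0 A \<alpha> q.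
            \<omega> \<and>\<^sub>w \<eta> \<in> log_forms0 A \<alpha> (CARD('n) - 1)) \<and>
        nondegenerate_pairing (log_forms0 A \<alpha> p) (log_forms0 A \<alpha> q)
          (int (card A) - int CARD('n)) (\<lambda>\<omega> \<eta>. \<psi> (\<omega> \<and>\<^sub>w \<eta>))) \<and>
      (\<forall>lam :: 'n cvec set \<Rightarrow> complex. (\<Sum>H\<in>A. lam H) = 0 \<longrightarrow>
        self_dual_via (CARD('n) - 1) (log_forms0 A \<alpha>) (\<lambda>\<omega>. omega_weight A \<alpha> lam \<and>\<^sub>w \<omega>)
          (int (card A) - int CARD('n))
          (\<lambda>p \<omega>. restrict (\<lambda>\<eta>. \<psi> (\<omega> \<and>\<^sub>w \<eta>)) (log_forms0 A \<alpha> (CARD('n) - 1 - p)))))"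
proof -
  interpret arrangement A \<alpha> by (rule arrangement_of_central_essential[OF assms])
  show ?thesis
    by (intro conjI allI impI ballI top_isomorphism_exists C_wedge_top
        wedge_nondegenerate_pairing wedge_omega_self_dual)
qed

end
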